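(* Let $(K,|\cdot|)$ be a non-Archimedean discretely valued field with finite residue field (e.g., a locally compact non-Archimedean nontrivially valued field), let $D$ be its ring of integers, and let $n\ge2$. Then any two bounded subsets of $K^n$ with nonempty interiors are $\mathrm{SA}(n,D,K)$-equidecomposable.
   Context: A non-Archimedean valuation on a field $K$ is a function $|\cdot|:K\to[0,\infty)$ with $|x|=0\iff x=0$, $|xy|=|x||y|$, $|x+y|\le\max\{|x|,|y|\}$. With $|K^*|=\{|x|:x\in K,x\ne0\}$, the valuation is discrete if $|K^*|\cap(0,1)$ is nonempty and has a maximum (so in particular the valuation is nontrivial). $D=\{x\in K:|x|\le1\}$ is the ring of integers, $\mathfrak m=\{x:|x|<1\}$, and the residue field is $D/\mathfrak m$. $K^n$ carries the norm $\|x\|=\max_i|x_i|$ and its induced metric and topology. $\mathrm{SA}(n,D,K)$ is the group of affine maps $K^n\to K^n$, $x\mapsto L(x)+\tau$, with $L\in\mathrm{SL}(n,D)$ and $\tau\in K^n$ (these are isometries of $K^n$). For a group $G$ acting on a set $X$, subsets $A,B\subseteq X$ are $G$-equidecomposable if for some $m\in\mathbb N$ there are partitions $A=\bigsqcup_{i=1}^mA_i$, $B=\bigsqcup_{i=1}^mB_i$ and $g_1,\dots,g_m\in G$ with $g_i(A_i)=B_i$ for all $i$. The axiom of choice is assumed. *)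

theory Defs
  imports "HOL-Analysis.Analysis"
begin

definition nonarch_valuation :: "('a::field \<Rightarrow> real) \<Rightarrow> bool" where
  "nonarch_valuation v \<longleftrightarrow>
     (\<forall>x. 0 \<le> v x) \<and>
     (\<forall>x. v x = 0 \<longleftrightarrow> x = 0) \<and>
     (\<forall>x y. v (x * y) = v x * v y) \<and>
     (\<forall>x y. v (x + y) \<le> max (v x) (v y))"

definition value_group :: "('a::field \<Rightarrow> real) \<Rightarrow> real set" where
  "value_group v = v ` {x. x \<noteq> 0}"

definition discrete_valuation :: "('a::field \<Rightarrow> real) \<Rightarrow> bool" where
  "discrete_valuation v \<longleftrightarrow>
     (\<exists>r \<in> value_group v \<inter> {0<..<1}. \<forall>s \<in> value_group v \<inter> {0<..<1}. s \<le> r)"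

definition ring_of_integers :: "('a::field \<Rightarrow> real) \<Rightarrow> 'a set" where
  "ring_of_integers v = {x. v x \<le> 1}"

definition maximal_ideal :: "('a::field \<Rightarrow> real) \<Rightarrow> 'a set" where
  "maximal_ideal v = {x. v x < 1}"

text \<open>Only the underlying set of the residue field is needed: the classes of the ring of integers
  modulo the maximal ideal.\<close>

definition residue_field :: "('a::field \<Rightarrow> real) \<Rightarrow> 'a set set" where
  "residue_field v =
     ring_of_integers v //
       {(x, y). x \<in> ring_of_integers v \<and> y \<in> ring_of_integers v \<and> x - y \<in> maximal_ideal v}"

definition vec_norm :: "('a::field \<Rightarrow> real) \<Rightarrow> 'a ^ 'n::finite \<Rightarrow> real" where
  "vec_norm v x = Max (range (\<lambda>i. v (x $ i)))"

definition vec_dist :: "('a::field \<Rightarrow> real) \<Rightarrow> 'a ^ 'n::finite \<Rightarrow> 'a ^ 'n \<Rightarrow> real" where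
  "vec_dist v x y = vec_norm v (x - y)"

text \<open>The valuation is an explicit function, so the metric topology and boundedness are those of
  the library's locale of explicit metric spaces. Outside that locale the constants are only
  meaningful for an actual metric, which the next lemma provides.\<close>

lemma Metric_space_vec_dist:
  fixes v :: "'a::field \<Rightarrow> real"
  assumes "nonarch_valuation v"
  shows "Metric_space (UNIV :: ('a ^ 'n::finite) set) (vec_dist v)"
proof -
  have nn: "0 \<le> v x" and z: "v x = 0 \<longleftrightarrow> x = 0" and m: "v (x * y) = v x * v y"
    and a: "v (x + y) \<le> max (v x) (v y)" for x y
    using assms by (auto simp: nonarch_valuation_def)
  have "v 1 = 1" using m[of 1 1] z[of 1] by auto
  then have "v (-1) * v (-1) = 1" using m[of "-1" "-1"] by simp
  then have "v (-1) = 1" using nn[of "-1"]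
    by (metis abs_of_nonneg power2_eq_1_iff power2_eq_square abs_1 abs_minus)
  then have sym: "v (x - y) = v (y - x)" for x y
    using m[of "-1" "x - y"] by simp
  have le: "v (x $ i) \<le> vec_norm v x" for x :: "'a ^ 'n" and i
    unfolding vec_norm_def by (rule Max_ge) auto
  have leI: "vec_norm v x \<le> c" if "\<And>i. v (x $ i) \<le> c" for x :: "'a ^ 'n" and c
    unfolding vec_norm_def using that by (subst Max_le_iff) auto
  have n0: "0 \<le> vec_norm v x" for x :: "'a ^ 'n"
    using le[of x] nn order_trans by blast
  show ?thesis
  proof
    fix x y w :: "'a ^ 'n"
    show "0 \<le> vec_dist v x y" by (simp add: vec_dist_def n0)
    show "vec_dist v x y = vec_dist v y x"
      by (simp add: vec_dist_def vec_norm_def sym)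
    show "vec_dist v x y = 0 \<longleftrightarrow> x = y"
    proof
      assume "vec_dist v x y = 0"
      then have "v ((x - y) $ i) = 0" for i
        using le[of "x - y" i] nn[of "(x - y) $ i"] by (simp add: vec_dist_def)
      then show "x = y" by (simp add: z vec_eq_iff)
    next
      assume "x = y"
      then show "vec_dist v x y = 0"
        using n0[of 0] leI[of 0 0] z[of 0] by (simp add: vec_dist_def)
    qed
    show "vec_dist v x w \<le> vec_dist v x y + vec_dist v y w"
      unfolding vec_dist_def
    proof (rule leI)
      fix i
      have "v ((x - w) $ i) \<le> max (v ((x - y) $ i)) (v ((y - w) $ i))"
        using a[of "(x - y) $ i" "(y - w) $ i"] by simp
      also have "\<dots> \<le> vec_norm v (x - y) + vec_norm v (y - w)"
        using le[of "x - y" i] le[of "y - w" i] n0[of "x - y"] n0[of "y - w"] by simp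
      finally show "v ((x - w) $ i) \<le> vec_norm v (x - y) + vec_norm v (y - w)" .
    qed
  qed
qed

definition vec_bounded :: "('a::field \<Rightarrow> real) \<Rightarrow> ('a ^ 'n::finite) set \<Rightarrow> bool" where
  "vec_bounded v A \<longleftrightarrow> Metric_space.mbounded UNIV (vec_dist v) A"

definition vec_interior :: "('a::field \<Rightarrow> real) \<Rightarrow> ('a ^ 'n::finite) set \<Rightarrow> ('a ^ 'n) set" where
  "vec_interior v A = Metric_space.mtopology UNIV (vec_dist v) interior_of A"

definition special_linear :: "'a::field set \<Rightarrow> ('a ^ 'n ^ 'n::finite) set" where
  "special_linear D = {L. (\<forall>i j. L $ i $ j \<in> D) \<and> det L = 1}"

definition special_affine :: "('a::field \<Rightarrow> real) \<Rightarrow> ('a ^ 'n::finite \<Rightarrow> 'a ^ 'n) set" where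
  "special_affine v =
     {f. \<exists>L \<tau>. L \<in> special_linear (ring_of_integers v) \<and> f = (\<lambda>x. L *v x + \<tau>)}"

text \<open>The group is given as a set \<open>G\<close> of transformations of the underlying space. Pieces may be
  empty, which makes no difference: \<open>P i\<close> is empty iff its image \<open>Q i\<close> is, and such pairs can be
  dropped.\<close>

definition equidecomposable :: "('x \<Rightarrow> 'x) set \<Rightarrow> 'x set \<Rightarrow> 'x set \<Rightarrow> bool" where
  "equidecomposable G A B \<longleftrightarrow>
     (\<exists>(m::nat) P Q g.
        disjoint_family_on P {1..m} \<and> (\<Union>i\<in>{1..m}. P i) = A \<and>
        disjoint_family_on Q {1..m} \<and> (\<Union>i\<in>{1..m}. Q i) = B \<and>
        (\<forall>i\<in>{1..m}. g i \<in> G \<and> g i ` P i = Q i))"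

end

theory Submission
  imports Defs
begin

text \<open>Let \<open>R\<close> be a subring of the ring of integers with an unbounded absolute value \<open>N\<close>:
  the integers in characteristic zero, the polynomials over the prime field in a uniformizer
  otherwise. On \<open>R\<^sup>2 - {0}\<close> the transvections \<open>(x, y) \<mapsto> (x + c y, y)\<close> and
  \<open>(x, y) \<mapsto> (x, y + c x)\<close>, for two values of \<open>c\<close> far apart, play ping-pong with the cones
  \<open>N x \<le> N y\<close> and \<open>N x > N y\<close>, which gives two disjoint piecewise copies of \<open>R\<^sup>2 - {0}\<close> inside
  itself. Every stabilizer in \<open>SL(2, R)\<close> of a nonzero vector of \<open>K\<^sup>2\<close> fixes a nonzero
  \<open>R\<close>-vector, so there is an equivariant map from \<open>K\<^sup>2 - {0}\<close> to \<open>R\<^sup>2 - {0}\<close>, along which the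
  duplication is pulled back. As transvections preserve balls, a ball without the locus
  \<open>x\<^sub>i = x\<^sub>j = 0\<close> is duplicated, and that locus is absorbed by a translation. Large balls are
  finite unions of translates of small ones because the residue field is finite, so every ball
  embeds piecewise into every set with nonempty interior, and the Banach-Schroeder-Bernstein
  argument finishes the proof.\<close>

section \<open>Piecewise maps\<close>

text \<open>No partition is recorded: a finite supply of group elements, one of which agrees with
  \<open>f\<close> at each point, composes and restricts more easily. Actual pieces are recovered
  only in \<open>equidecomposable_if_piecewise\<close>.\<close>

definition piecewise :: "('x \<Rightarrow> 'x) set \<Rightarrow> 'x set \<Rightarrow> ('x \<Rightarrow> 'x) \<Rightarrow> bool" where
  "piecewise G A f \<longleftrightarrow> (\<exists>S. finite S \<and> S \<subseteq> G \<and> (\<forall>x\<in>A. \<exists>g\<in>S. f x = g x))"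

lemma piecewise_subset: "piecewise G A f \<Longrightarrow> B \<subseteq> A \<Longrightarrow> piecewise G B f"
  unfolding piecewise_def by blast

lemma piecewise_single: "g \<in> G \<Longrightarrow> piecewise G A g"
  unfolding piecewise_def by (rule exI[of _ "{g}"]) auto

lemma piecewise_If:
  assumes "piecewise G {x\<in>A. p x} f" "piecewise G {x\<in>A. \<not> p x} h"
  shows "piecewise G A (\<lambda>x. if p x then f x else h x)"
proof -
  obtain S T where "finite S" "S \<subseteq> G" "\<forall>x\<in>{x\<in>A. p x}. \<exists>g\<in>S. f x = g x"
    and "finite T" "T \<subseteq> G" "\<forall>x\<in>{x\<in>A. \<not> p x}. \<exists>g\<in>T. h x = g x"
    using assms unfolding piecewise_def by auto
  then show ?thesis
    unfolding piecewise_def by (intro exI[of _ "S \<union> T"]) auto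
qed

text \<open>Because only finitely many labels occur, the union of the finite sets of group elements
  for the separate labels is still finite. Later the label of a point is the centre of a small box
  containing it.\<close>

lemma piecewise_choice:
  assumes "finite T" "\<tau> ` A \<subseteq> T" and "\<And>t. t \<in> T \<Longrightarrow> piecewise G {x\<in>A. \<tau> x = t} (f t)"
  shows "piecewise G A (\<lambda>x. f (\<tau> x) x)"
proof -
  have "\<exists>S. \<forall>t\<in>T. finite (S t) \<and> S t \<subseteq> G \<and> (\<forall>x\<in>{x\<in>A. \<tau> x = t}. \<exists>g\<in>S t. f t x = g x)"
    using assms(3) unfolding piecewise_def by (intro bchoice ballI)
  then obtain S where S: "\<forall>t\<in>T. finite (S t) \<and> S t \<subseteq> G \<and>
      (\<forall>x\<in>{x\<in>A. \<tau> x = t}. \<exists>g\<in>S t. f t x = g x)"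
    by (rule exE)
  then have "\<exists>g\<in>\<Union> (S ` T). f (\<tau> x) x = g x" if "x \<in> A" for x
    using assms(2) that by fastforce
  then show ?thesis
    unfolding piecewise_def using S assms(1) by (intro exI[of _ "\<Union> (S ` T)"]) auto
qed

text \<open>Several elements of \<open>S\<close> may agree with \<open>f\<close> at the same point,
  so one index is chosen per point and the pieces are the fibres of this choice. Their images are
  disjoint because \<open>f\<close> is injective.\<close>

lemma equidecomposable_if_piecewise:
  assumes bij: "bij_betw f A B" and pw: "piecewise G A f"
  shows "equidecomposable G A B"
proof -
  obtain S where S: "finite S" "S \<subseteq> G" "\<forall>x\<in>A. \<exists>g\<in>S. f x = g x"
    using pw unfolding piecewise_def by auto
  obtain e where e: "bij_betw e {1..card S} S"
    using ex_bij_betw_nat_finite_1[OF S(1)] by auto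
  have "\<exists>k. k \<in> {1..card S} \<and> f x = e k x" if x: "x \<in> A" for x
  proof -
    obtain g where "g \<in> S" "f x = g x" using S(3) x by auto
    moreover then obtain k where "k \<in> {1..card S}" "e k = g"
      using e unfolding bij_betw_def by (metis imageE)
    ultimately show ?thesis by auto
  qed
  then obtain idx where idx: "\<And>x. x \<in> A \<Longrightarrow> idx x \<in> {1..card S} \<and> f x = e (idx x) x"
    by metis
  define P where "P k = {x\<in>A. idx x = k}" for k
  have inj: "inj_on f A" and im: "f ` A = B" using bij by (auto simp: bij_betw_def)
  have "disjoint_family_on P {1..card S}"
    unfolding disjoint_family_on_def P_def by auto
  moreover have UP: "(\<Union>k\<in>{1..card S}. P k) = A" unfolding P_def using idx by auto
  moreover have "disjoint_family_on (\<lambda>k. f ` P k) {1..card S}"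
    unfolding disjoint_family_on_def P_def using inj by (auto dest: inj_onD)
  moreover have "(\<Union>k\<in>{1..card S}. f ` P k) = B" using UP im by blast
  moreover have "e k \<in> G \<and> e k ` P k = f ` P k" if "k \<in> {1..card S}" for k
  proof
    show "e k \<in> G" using e S(2) that unfolding bij_betw_def by auto
    show "e k ` P k = f ` P k" unfolding P_def by (rule image_cong) (use idx in auto)
  qed
  ultimately have "disjoint_family_on P {1..card S} \<and> (\<Union>k\<in>{1..card S}. P k) = A \<and>
      disjoint_family_on (\<lambda>k. f ` P k) {1..card S} \<and> (\<Union>k\<in>{1..card S}. f ` P k) = B \<and>
      (\<forall>k\<in>{1..card S}. e k \<in> G \<and> e k ` P k = f ` P k)"
    by (intro conjI ballI) blast+
  then show ?thesis
    unfolding equidecomposable_def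
    by - (rule exI[of _ "card S"], rule exI[of _ P], rule exI[of _ "\<lambda>k. f ` P k"],
      rule exI[of _ e], assumption)
qed

lemma equidecomposable_mono: "equidecomposable G A B \<Longrightarrow> G \<subseteq> H \<Longrightarrow> equidecomposable H A B"
  unfolding equidecomposable_def by (elim ex_forward conj_forward) auto

text \<open>Asking for left inverses is enough: in a set closed under them, a left inverse has a
  left inverse itself and is therefore two-sided.\<close>

locale transformation_group =
  fixes G :: "('x \<Rightarrow> 'x) set"
  assumes id_mem: "(\<lambda>x. x) \<in> G"
    and comp_mem: "g \<in> G \<Longrightarrow> h \<in> G \<Longrightarrow> (\<lambda>x. g (h x)) \<in> G"
    and inverse_mem: "g \<in> G \<Longrightarrow> \<exists>h\<in>G. \<forall>x. h (g x) = x"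
begin

lemma piecewise_comp:
  assumes "piecewise G A f" "f ` A \<subseteq> B" "piecewise G B h"
  shows "piecewise G A (\<lambda>x. h (f x))"
proof -
  obtain S T where S: "finite S" "S \<subseteq> G" "\<forall>x\<in>A. \<exists>g\<in>S. f x = g x"
    and T: "finite T" "T \<subseteq> G" "\<forall>x\<in>B. \<exists>g\<in>T. h x = g x"
    using assms unfolding piecewise_def by auto
  define C where "C = (\<lambda>(s, t) x. t (s x)) ` (S \<times> T)"
  have "finite C" using S T unfolding C_def by auto
  moreover have "C \<subseteq> G" 
  proof -
    have "(\<lambda>x. t (s x)) \<in> G" if "s \<in> S" "t \<in> T" for s t
      using that S(2) T(2) by (intro comp_mem[of t s]) auto
    then show ?thesis unfolding C_def by auto
  qed
  moreover have "\<exists>g\<in>C. h (f x) = g x" if "x \<in> A" for x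
  proof -
    have "f x \<in> B" using assms(2) that by auto
    then obtain s t where "s \<in> S" "f x = s x" "t \<in> T" "h (f x) = t (f x)"
      using S(3) T(3) \<open>x \<in> A\<close> by metis
    moreover have "(\<lambda>x. t (s x)) \<in> C"
      unfolding C_def using \<open>s \<in> S\<close> \<open>t \<in> T\<close> by (intro image_eqI[of _ _ "(s, t)"]) auto
    ultimately show ?thesis by (intro bexI[of _ "\<lambda>x. t (s x)"]) simp_all
  qed
  ultimately show ?thesis unfolding piecewise_def by blast
qed

lemma piecewise_inv_into:
  assumes inj: "inj_on f A" and "piecewise G A f"
  shows "piecewise G (f ` A) (inv_into A f)"
proof -
  obtain S where S: "finite S" "S \<subseteq> G" "\<forall>x\<in>A. \<exists>g\<in>S. f x = g x"
    using assms unfolding piecewise_def by auto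
  obtain i where i: "\<And>g. g \<in> G \<Longrightarrow> i g \<in> G \<and> (\<forall>x. i g (g x) = x)"
    using inverse_mem by metis
  have "\<exists>g\<in>i ` S. inv_into A f y = g y" if y: "y \<in> f ` A" for y
  proof -
    obtain x where x: "x \<in> A" "y = f x" using y by auto
    then obtain g where g: "g \<in> S" "f x = g x" using S(3) by auto
    have "inv_into A f y = x" using x inj by simp
    moreover have "i g y = x" using g x i S(2) by auto
    ultimately have "inv_into A f y = i g y" by simp
    then show ?thesis using g(1) by blast
  qed
  then show ?thesis
    unfolding piecewise_def using S i by (intro exI[of _ "i ` S"]) auto
qed

theorem Banach_Schroeder_Bernstein:
  assumes f: "inj_on f A" "f ` A \<subseteq> B" "piecewise G A f"
    and h: "inj_on h B" "h ` B \<subseteq> A" "piecewise G B h"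
  shows "equidecomposable G A B"
proof -
  \<comment> \<open>A fixed point \<open>E\<close> satisfies \<open>A - E = h\<close> (B - f
    \<open>E)\<close>, so \<open>f\<close> on \<open>E\<close> and the inverse of \<open>h\<close>
    on \<open>A - E\<close> fit together to a bijection onto \<open>B\<close>. It exists because
    \<open>F\<close> is monotone.\<close>
  define F where "F = (\<lambda>E. A - h ` (B - f ` E))"
  define E where "E = lfp F"
  have "mono F" unfolding F_def mono_def by blast
  then have "E = F E" unfolding E_def by (rule lfp_unfold)
  then have EA: "E \<subseteq> A" and AE: "A - E = h ` (B - f ` E)"
    using h(2) unfolding F_def by blast+
  define k where "k x = (if x \<in> E then f x else inv_into B h x)" for x
  have "bij_betw (inv_into B h) (A - E) (B - f ` E)"
    unfolding bij_betw_def
  proof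
    show "inj_on (inv_into B h) (A - E)"
      unfolding AE by (rule inj_on_inv_into) auto
    show "inv_into B h ` (A - E) = B - f ` E"
      unfolding AE using h(1) by (simp add: image_image)
  qed
  then have "bij_betw k (A - E) (B - f ` E)"
    by (subst bij_betw_cong[of _ _ "inv_into B h"]) (auto simp: k_def)
  moreover have "bij_betw k E (f ` E)"
    using f(1) EA by (subst bij_betw_cong[of _ _ f])
      (auto simp: k_def bij_betw_def intro: inj_on_subset)
  ultimately have "bij_betw k (E \<union> (A - E)) (f ` E \<union> (B - f ` E))"
    by (intro bij_betw_combine) auto
  moreover have "E \<union> (A - E) = A" "f ` E \<union> (B - f ` E) = B" using EA f(2) by auto
  ultimately have bij: "bij_betw k A B" by simp
  have "piecewise G {x\<in>A. x \<in> E} f" by (rule piecewise_subset[OF f(3)]) auto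
  moreover have "piecewise G {x\<in>A. x \<notin> E} (inv_into B h)"
    by (rule piecewise_subset[OF piecewise_inv_into[OF h(1,3)]]) (use AE in blast)
  ultimately have "piecewise G A k" unfolding k_def[abs_def] by (rule piecewise_If)
  with bij show ?thesis by (rule equidecomposable_if_piecewise)
qed

text \<open>One representative per orbit is sent to any point with a larger stabilizer.\<close>

lemma equivariant_map_exists:
  assumes X: "\<And>g x. g \<in> G \<Longrightarrow> x \<in> X \<Longrightarrow> g x \<in> X"
    and Y: "\<And>g y. g \<in> G \<Longrightarrow> y \<in> Y \<Longrightarrow> g y \<in> Y"
    and stab: "\<And>x. x \<in> X \<Longrightarrow> \<exists>y\<in>Y. \<forall>g\<in>G. g x = x \<longrightarrow> g y = y"
  shows "\<exists>\<phi>. (\<forall>x\<in>X. \<phi> x \<in> Y) \<and> (\<forall>g\<in>G. \<forall>x\<in>X. \<phi> (g x) = g (\<phi> x))"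
proof -
  obtain i where "\<And>g. g \<in> G \<Longrightarrow> i g \<in> G \<and> (\<forall>x. i g (g x) = x)"
    using inverse_mem by metis
  then have i: "\<And>g. g \<in> G \<Longrightarrow> i g \<in> G" "\<And>g x. g \<in> G \<Longrightarrow> i g (g x) = x"
    by auto
  \<comment> \<open>Apply the left inverse of \<open>i g\<close> to the equation
    \<open>i g (g (i g x)) = i g x\<close>.\<close>
  have ii: "g (i g x) = x" if "g \<in> G" for g x
    using i(2)[OF i(1)[OF that], of "g (i g x)"] i(2)[OF that] i(2)[OF i(1)[OF that]] by simp
  define orb where "orb x = (\<lambda>g. g x) ` G" for x
  \<comment> \<open>The choice depends on the orbit as a set only, so all points of one orbit
    receive the same representative.\<close>
  define rep where "rep x = (SOME m. m \<in> orb x)" for x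
  have orb_eq: "orb (g x) = orb x" if g: "g \<in> G" for g x
  proof -
    have "h x \<in> orb (g x)" if "h \<in> G" for h
      unfolding orb_def by (rule image_eqI[of _ _ "\<lambda>z. h (i g z)"])
        (simp_all add: i comp_mem[OF that i(1)[OF g]] g)
    moreover have "h (g x) \<in> orb x" if "h \<in> G" for h
      unfolding orb_def by (rule image_eqI[of _ _ "\<lambda>z. h (g z)"])
        (simp_all add: comp_mem[OF that g])
    ultimately show ?thesis unfolding orb_def by auto
  qed
  have "x \<in> orb x" for x unfolding orb_def using id_mem by auto
  then have rep: "rep x \<in> orb x" for x unfolding rep_def by (rule someI)
  have rep_X: "rep x \<in> X" if "x \<in> X" for x
    using rep[of x] X that unfolding orb_def by auto
  have "\<exists>g. g \<in> G \<and> g (rep x) = x" for x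
  proof -
    obtain g where "g \<in> G" "rep x = g x" using rep[of x] unfolding orb_def by blast
    then show ?thesis using i by (intro exI[of _ "i g"]) simp
  qed
  then have "\<exists>t. \<forall>x. t x \<in> G \<and> t x (rep x) = x" by (intro choice allI)
  then obtain t where "\<forall>x. t x \<in> G \<and> t x (rep x) = x" by (rule exE)
  then have t: "\<And>x. t x \<in> G" "\<And>x. t x (rep x) = x" by simp_all
  have "\<exists>y. \<forall>x\<in>X. y x \<in> Y \<and> (\<forall>g\<in>G. g x = x \<longrightarrow> g (y x) = y x)"
    using stab by (intro bchoice ballI) (simp add: Bex_def)
  then obtain y where "\<forall>x\<in>X. y x \<in> Y \<and> (\<forall>g\<in>G. g x = x \<longrightarrow> g (y x) = y x)" by (rule exE)
  then have y: "\<And>x. x \<in> X \<Longrightarrow> y x \<in> Y"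
    "\<And>x g. x \<in> X \<Longrightarrow> g \<in> G \<Longrightarrow> g x = x \<Longrightarrow> g (y x) = y x"
    by simp_all
  define \<phi> where "\<phi> x = t x (y (rep x))" for x
  show ?thesis
  proof (intro exI[of _ \<phi>] conjI ballI)
    show "\<phi> x \<in> Y" if "x \<in> X" for x
      unfolding \<phi>_def by (rule Y[OF t(1) y(1)[OF rep_X[OF that]]])
    show "\<phi> (g x) = g (\<phi> x)" if g: "g \<in> G" and x: "x \<in> X" for g x
    proof -
      have r: "rep (g x) = rep x" unfolding rep_def orb_eq[OF g] ..
      \<comment> \<open>Going from \<open>rep x\<close> to \<open>x\<close>, then by
        \<open>g\<close> to \<open>g x\<close>, and back to the common representative is an element
        of the stabilizer of \<open>rep x\<close>. It fixes \<open>y (rep x)\<close>, so the two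
        ways of transporting that point agree.\<close>
      define k where "k = (\<lambda>z. i (t (g x)) (g (t x z)))"
      have "k \<in> G" unfolding k_def
        using comp_mem[OF i(1)[OF t(1)] comp_mem[OF g t(1)]] by simp
      moreover have "k (rep x) = rep x"
        unfolding k_def using t(2)[of x] t(2)[of "g x"] i(2)[OF t(1)[of "g x"], of "rep x"] r by simp
      ultimately have "k (y (rep x)) = y (rep x)" using y(2) rep_X[OF x] by auto
      then have "t (g x) (k (y (rep x))) = t (g x) (y (rep x))" by simp
      then show ?thesis unfolding \<phi>_def r by (simp add: k_def ii[OF t(1)])
    qed
  qed
qed

end

section \<open>A paradoxical action of the special linear group of a subring\<close>

definition transvection :: "'n \<Rightarrow> 'n \<Rightarrow> 'a::field \<Rightarrow> 'a ^ 'n::finite \<Rightarrow> 'a ^ 'n" where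
  "transvection i j c x = (\<chi> k. if k = i then x $ i + c * x $ j else x $ k)"

lemma transvection_nth:
  "transvection i j c x $ k = (if k = i then x $ i + c * x $ j else x $ k)"
  by (simp add: transvection_def)

lemma transvection_inverse: "i \<noteq> j \<Longrightarrow> transvection i j (- c) (transvection i j c x) = x"
  by (simp add: vec_eq_iff transvection_nth)

lemma transvection_inject [simp]:
  "i \<noteq> j \<Longrightarrow> transvection i j c x = transvection i j c y \<longleftrightarrow> x = y"
  by (metis transvection_inverse)

text \<open>The 2 by 2 action is written on the whole space at once, so that no slicing into planes
  parallel to the coordinates \<open>i\<close> and \<open>j\<close> is needed.\<close>

definition plane_map :: "'n \<Rightarrow> 'n \<Rightarrow> 'a \<Rightarrow> 'a \<Rightarrow> 'a \<Rightarrow> 'a::field \<Rightarrow> 'a ^ 'n::finite \<Rightarrow> 'a ^ 'n" where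
  "plane_map i j p q r s x =
     (\<chi> k. if k = i then p * x $ i + q * x $ j else if k = j then r * x $ i + s * x $ j else x $ k)"

lemma plane_map_nth:
  "plane_map i j p q r s x $ k =
     (if k = i then p * x $ i + q * x $ j else if k = j then r * x $ i + s * x $ j else x $ k)"
  by (simp add: plane_map_def)

text \<open>\<open>N\<close> is not tied to the valuation. In the applications \<open>v\<close> is
  at most 1 on \<open>R\<close>, while ping-pong needs a size with large values there; it only has
  to be multiplicative and to satisfy the triangle inequality.\<close>

locale normed_subring =
  fixes R :: "'a::field set" and N :: "'a \<Rightarrow> real"
  assumes one_mem: "1 \<in> R" and diff_mem: "x \<in> R \<Longrightarrow> y \<in> R \<Longrightarrow> x - y \<in> R"
    and mult_mem: "x \<in> R \<Longrightarrow> y \<in> R \<Longrightarrow> x * y \<in> R"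
    and norm_nonneg: "x \<in> R \<Longrightarrow> 0 \<le> N x"
    and norm_eq_0_iff: "x \<in> R \<Longrightarrow> N x = 0 \<longleftrightarrow> x = 0"
    and norm_mult: "x \<in> R \<Longrightarrow> y \<in> R \<Longrightarrow> N (x * y) = N x * N y"
    and norm_diff: "x \<in> R \<Longrightarrow> y \<in> R \<Longrightarrow> N (x - y) \<le> N x + N y"
begin

lemma zero_mem: "0 \<in> R"
  using diff_mem[OF one_mem one_mem] by simp

lemma minus_mem: "x \<in> R \<Longrightarrow> - x \<in> R"
  using diff_mem[OF zero_mem] by fastforce

lemma add_mem: "x \<in> R \<Longrightarrow> y \<in> R \<Longrightarrow> x + y \<in> R"
  using diff_mem[OF _ minus_mem] by fastforce

definition plane_group :: "'n \<Rightarrow> 'n \<Rightarrow> ('a ^ 'n::finite \<Rightarrow> 'a ^ 'n) set" where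
  "plane_group i j =
     {g. \<exists>p\<in>R. \<exists>q\<in>R. \<exists>r\<in>R. \<exists>s\<in>R. p * s - q * r = 1 \<and> g = plane_map i j p q r s}"

lemma plane_groupI:
  "\<lbrakk>p \<in> R; q \<in> R; r \<in> R; s \<in> R; p * s - q * r = 1; g = plane_map i j p q r s\<rbrakk>
     \<Longrightarrow> g \<in> plane_group i j"
  unfolding plane_group_def by blast

lemma plane_groupE:
  assumes "g \<in> plane_group i j"
  obtains p q r s where "p \<in> R" "q \<in> R" "r \<in> R" "s \<in> R" "p * s - q * r = 1"
    "g = plane_map i j p q r s"
  using assms unfolding plane_group_def by blast

lemma transvection_in_plane_group:
  assumes "i \<noteq> j" "c \<in> R"
  shows "transvection i j c \<in> plane_group i j" "transvection j i c \<in> plane_group i j"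
  by (rule plane_groupI[OF one_mem assms(2) zero_mem one_mem],
      use assms(1) in \<open>auto simp: fun_eq_iff vec_eq_iff transvection_nth plane_map_nth\<close>,
      rule plane_groupI[OF one_mem zero_mem assms(2) one_mem],
      use assms(1) in \<open>auto simp: fun_eq_iff vec_eq_iff transvection_nth plane_map_nth\<close>)

lemma transformation_group_plane_group:
  assumes ij: "i \<noteq> j"
  shows "transformation_group (plane_group i j)"
proof
  show "(\<lambda>x. x) \<in> plane_group i j"
    by (rule plane_groupI[OF one_mem zero_mem zero_mem one_mem])
      (auto simp: fun_eq_iff vec_eq_iff plane_map_nth)
next
  fix g h assume g: "g \<in> plane_group i j" and h: "h \<in> plane_group i j"
  obtain p q r s where m: "p \<in> R" "q \<in> R" "r \<in> R" "s \<in> R" and d: "p * s - q * r = 1"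
    and g: "g = plane_map i j p q r s"
    using g by (elim plane_groupE)
  obtain p' q' r' s' where m': "p' \<in> R" "q' \<in> R" "r' \<in> R" "s' \<in> R"
    and d': "p' * s' - q' * r' = 1" and h: "h = plane_map i j p' q' r' s'"
    using h by (elim plane_groupE)
  have "(p * p' + q * r') * (r * q' + s * s') - (p * q' + q * s') * (r * p' + s * r')
    = (p * s - q * r) * (p' * s' - q' * r')"
    by (simp add: algebra_simps)
  then have "(p * p' + q * r') * (r * q' + s * s') - (p * q' + q * s') * (r * p' + s * r') = 1"
    using d d' by simp
  moreover have "(\<lambda>x. g (h x)) = plane_map i j (p * p' + q * r') (p * q' + q * s')
      (r * p' + s * r') (r * q' + s * s')"
    using ij by (simp add: g h fun_eq_iff vec_eq_iff plane_map_nth algebra_simps)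
  ultimately show "(\<lambda>x. g (h x)) \<in> plane_group i j"
    by (rule plane_groupI[rotated 4]) (use m m' in \<open>auto intro: add_mem mult_mem\<close>)
next
  fix g assume "g \<in> plane_group i j"
  then obtain p q r s where
    m: "p \<in> R" "q \<in> R" "r \<in> R" "s \<in> R" and d: "p * s - q * r = 1" and g: "g = plane_map i j p q r s"
    by (elim plane_groupE) blast
  have "plane_map i j s (- q) (- r) p (g x) = x" for x
  proof -
    have "s * (p * x $ i + q * x $ j) - q * (r * x $ i + s * x $ j) = (p * s - q * r) * x $ i"
      "p * (r * x $ i + s * x $ j) - r * (p * x $ i + q * x $ j) = (p * s - q * r) * x $ j"
      by (simp_all add: algebra_simps)
    then show ?thesis using ij d by (simp add: g vec_eq_iff plane_map_nth)
  qed
  moreover have "plane_map i j s (- q) (- r) p \<in> plane_group i j"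
    using m d by (intro plane_groupI[OF _ _ _ _ _ refl]) (auto intro: minus_mem simp: mult.commute)
  ultimately show "\<exists>h\<in>plane_group i j. \<forall>x. h (g x) = x" by blast
qed

text \<open>Multiplying by the adjugate matrix recovers the coordinates \<open>i\<close> and
  \<open>j\<close> of \<open>x\<close> from those of its image, since the determinant is 1.\<close>

lemma plane_map_nonzero:
  assumes "i \<noteq> j" "p * s - q * r = 1" "x $ i \<noteq> 0 \<or> x $ j \<noteq> 0"
  shows "plane_map i j p q r s x $ i \<noteq> 0 \<or> plane_map i j p q r s x $ j \<noteq> 0"
proof (rule ccontr)
  assume "\<not> ?thesis"
  then have z: "p * x $ i + q * x $ j = 0" "r * x $ i + s * x $ j = 0"
    using assms(1) by (auto simp: plane_map_nth)
  have "(p * s - q * r) * x $ i = s * (p * x $ i + q * x $ j) - q * (r * x $ i + s * x $ j)"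
    "(p * s - q * r) * x $ j = p * (r * x $ i + s * x $ j) - r * (p * x $ i + q * x $ j)"
    by (simp_all add: algebra_simps)
  then show False using z assms by simp
qed

text \<open>If a matrix \<open>g \<noteq> 1\<close> over \<open>R\<close> fixes a vector \<open>x\<close>, then \<open>x\<close> is orthogonal
  to a nonzero \<open>R\<close>-vector \<open>(a, b)\<close>, hence proportional to \<open>(b, - a)\<close>.\<close>

lemma stabilizer_fixes_lattice_point:
  assumes ij: "i \<noteq> j" and x: "x $ i \<noteq> 0 \<or> x $ j \<noteq> 0"
  shows "\<exists>y\<in>{y. y $ i \<in> R \<and> y $ j \<in> R \<and> (y $ i \<noteq> 0 \<or> y $ j \<noteq> 0)}.
    \<forall>g\<in>plane_group i j. g x = x \<longrightarrow> g y = y"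
proof (cases "\<exists>a\<in>R. \<exists>b\<in>R. (a \<noteq> 0 \<or> b \<noteq> 0) \<and> a * x $ i + b * x $ j = 0")
  case True
  then obtain a b where ab: "a \<in> R" "b \<in> R" "a \<noteq> 0 \<or> b \<noteq> 0" "a * x $ i + b * x $ j = 0"
    by blast
  define y where "y = (\<chi> k. if k = i then b else if k = j then - a else 0)"
  have yi: "y $ i = b" "y $ j = - a" using ij by (auto simp: y_def)
  \<comment> \<open>Two rows that annihilate the same nonzero vector are linearly dependent. This is
    applied to the two rows of \<open>g - 1\<close>, which annihilate \<open>x\<close> when
    \<open>g\<close> fixes \<open>x\<close>.\<close>
  have det0: "e * b - f * a = 0" if "e * x $ i + f * x $ j = 0" for e f
  proof -
    have "(e * b - f * a) * x $ i = b * (e * x $ i + f * x $ j) - f * (a * x $ i + b * x $ j)"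
      "(e * b - f * a) * x $ j = e * (a * x $ i + b * x $ j) - a * (e * x $ i + f * x $ j)"
      by (simp_all add: algebra_simps)
    then show ?thesis using x that ab(4) by auto
  qed
  show ?thesis
  proof (intro bexI[of _ y] ballI impI)
    show "y \<in> {y. y $ i \<in> R \<and> y $ j \<in> R \<and> (y $ i \<noteq> 0 \<or> y $ j \<noteq> 0)}"
      using yi ab minus_mem by auto
    fix g assume "g \<in> plane_group i j" "g x = x"
    then obtain p q r s where g: "g = plane_map i j p q r s" by (elim plane_groupE)
    have "g x $ i = x $ i" "g x $ j = x $ j" using \<open>g x = x\<close> by simp_all
    then have "(p - 1) * x $ i + q * x $ j = 0" "r * x $ i + (s - 1) * x $ j = 0"
      using ij by (simp_all add: g plane_map_nth algebra_simps)
    then have "(p - 1) * b - q * a = 0" "r * b - (s - 1) * a = 0" using det0 by auto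
    then show "g y = y"
      using ij yi by (auto simp: g vec_eq_iff plane_map_nth algebra_simps)
  qed
next
  case False
  \<comment> \<open>Without an \<open>R\<close>-linear relation between the two coordinates of
    \<open>x\<close>, both rows of \<open>g - 1\<close> vanish. The stabilizer is then trivial and
    any nonzero \<open>R\<close>-vector will do.\<close>
  define y :: "'a ^ 'b" where "y = (\<chi> k. if k = i then 1 else 0)"
  show ?thesis
  proof (intro bexI[of _ y] ballI impI)
    show "y \<in> {y. y $ i \<in> R \<and> y $ j \<in> R \<and> (y $ i \<noteq> 0 \<or> y $ j \<noteq> 0)}"
      using ij one_mem zero_mem by (auto simp: y_def)
    fix g assume "g \<in> plane_group i j" "g x = x"
    then obtain p q r s where g: "g = plane_map i j p q r s"
      and m: "p \<in> R" "q \<in> R" "r \<in> R" "s \<in> R" by (elim plane_groupE)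
    have "g x $ i = x $ i" "g x $ j = x $ j" using \<open>g x = x\<close> by simp_all
    then have "(p - 1) * x $ i + q * x $ j = 0" "r * x $ i + (s - 1) * x $ j = 0"
      using ij by (simp_all add: g plane_map_nth algebra_simps)
    moreover have "p - 1 \<in> R" "s - 1 \<in> R" using m one_mem diff_mem by auto
    ultimately have "p - 1 = 0 \<and> q = 0" "r = 0 \<and> s - 1 = 0" using False m by blast+
    then show "g y = y" by (auto simp: g vec_eq_iff plane_map_nth)
  qed
qed

text \<open>Ping-pong on the cones \<open>N x \<le> N y\<close> and \<open>N x > N y\<close> of \<open>R\<^sup>2\<close>.\<close>

lemma transvection_crosses_cone:
  assumes "c \<in> R" "N c > 2" "x \<in> R" "y \<in> R" "x \<noteq> 0 \<or> y \<noteq> 0" "N x \<le> N y"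
  shows "N y < N (x + c * y)"
proof -
  have "y \<noteq> 0"
    using assms norm_nonneg[of x] norm_eq_0_iff[of x] norm_eq_0_iff[of y] by auto
  then have y: "N y > 0" using norm_nonneg[of y] norm_eq_0_iff[of y] assms by auto
  have "N c * N y = N ((x + c * y) - x)" using assms norm_mult by simp
  also have "\<dots> \<le> N (x + c * y) + N x" using assms by (intro norm_diff add_mem mult_mem)
  finally have "N c * N y \<le> N (x + c * y) + N x" .
  moreover have "N c * N y > 2 * N y" using y assms by simp
  ultimately show ?thesis using assms by linarith
qed

text \<open>For \<open>c \<noteq> d\<close> the element \<open>(c - d) * y = x' - x\<close> would
  have size above \<open>2 * N y\<close>, whereas two first coordinates in the cone differ by at
  most \<open>2 * N y\<close>.\<close>

lemma transvections_separate_cone: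
  assumes "c \<in> R" "d \<in> R" "c \<noteq> d \<longrightarrow> N (c - d) > 2"
    and "x \<in> R" "x' \<in> R" "y \<in> R" "x \<noteq> 0 \<or> y \<noteq> 0" "N x \<le> N y" "N x' \<le> N y"
    and eq: "x + c * y = x' + d * y"
  shows "c = d"
proof (rule ccontr)
  assume "c \<noteq> d"
  have "y \<noteq> 0"
    using assms norm_nonneg[of x] norm_eq_0_iff[of x] norm_eq_0_iff[of y] by auto
  then have y: "N y > 0" using norm_nonneg[of y] norm_eq_0_iff[of y] assms by auto
  have "(c - d) * y = x' - x" using eq by (simp add: algebra_simps)
  then have "N (c - d) * N y = N (x' - x)"
    using norm_mult[of "c - d" y] assms diff_mem by simp
  also have "\<dots> \<le> N x' + N x" using assms by (intro norm_diff)
  also have "\<dots> \<le> 2 * N y" using assms by simp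
  finally have "N (c - d) \<le> 2" using y by simp
  then show False using assms \<open>c \<noteq> d\<close> by auto
qed

text \<open>Joint injectivity in the pair \<open>(c, x)\<close> packs two facts together: each
  \<open>c\<close> in \<open>T\<close> gives an injective copy of the set, and copies for different
  \<open>c\<close> are disjoint. The predicate \<open>P x\<close> records which cone contains the
  lattice point equivariantly attached to \<open>x\<close>.\<close>

lemma plane_paradox:
  fixes i j :: "'n::finite"
  assumes ij: "i \<noteq> j"
    and T: "T \<subseteq> R" "\<And>c. c \<in> T \<Longrightarrow> N c > 2"
      "\<And>c d. c \<in> T \<Longrightarrow> d \<in> T \<Longrightarrow> c \<noteq> d \<Longrightarrow> N (c - d) > 2"
  shows "\<exists>P. inj_on (\<lambda>(c, x :: 'a ^ 'n). if P x then transvection i j c x else transvection j i c x)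
    (T \<times> {x. x $ i \<noteq> 0 \<or> x $ j \<noteq> 0})"
proof -
  interpret transformation_group "plane_group i j :: ('a ^ 'n \<Rightarrow> 'a ^ 'n) set"
    by (rule transformation_group_plane_group[OF ij])
  define X :: "('a ^ 'n) set" where "X = {x. x $ i \<noteq> 0 \<or> x $ j \<noteq> 0}"
  define Y where "Y = {y \<in> X. y $ i \<in> R \<and> y $ j \<in> R}"
  have X: "g x \<in> X" if "g \<in> plane_group i j" "x \<in> X" for g x
  proof -
    obtain p q r s where "g = plane_map i j p q r s" "p * s - q * r = 1"
      using \<open>g \<in> plane_group i j\<close> by (elim plane_groupE)
    then show ?thesis
      using plane_map_nonzero[OF ij, of p s q r x] \<open>x \<in> X\<close> unfolding X_def by simp
  qed
  have Y: "g x \<in> Y" if "g \<in> plane_group i j" "x \<in> Y" for g x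
  proof -
    obtain p q r s where "g = plane_map i j p q r s" "p \<in> R" "q \<in> R" "r \<in> R" "s \<in> R"
      using \<open>g \<in> plane_group i j\<close> by (elim plane_groupE)
    then show ?thesis
      using that X[OF that(1)] ij unfolding Y_def
      by (simp add: plane_map_nth add_mem mult_mem)
  qed
  have "\<exists>\<phi>. (\<forall>x\<in>X. \<phi> x \<in> Y) \<and> (\<forall>g\<in>plane_group i j. \<forall>x\<in>X. \<phi> (g x) = g (\<phi> x))"
  proof (rule equivariant_map_exists[of X Y])
    show "\<exists>y\<in>Y. \<forall>g\<in>plane_group i j. g x = x \<longrightarrow> g y = y" if "x \<in> X" for x
      using stabilizer_fixes_lattice_point[OF ij, of x] that unfolding X_def Y_def by auto
  qed (erule (1) X, erule (1) Y)
  then obtain \<phi> where \<phi>_ex: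
    "(\<forall>x\<in>X. \<phi> x \<in> Y) \<and> (\<forall>g\<in>plane_group i j. \<forall>x\<in>X. \<phi> (g x) = g (\<phi> x))"
    by (rule exE)
  note \<phi>Y = bspec[OF conjunct1[OF \<phi>_ex]]
    and \<phi> = bspec[OF bspec[OF conjunct2[OF \<phi>_ex]]]
  define C where "C y \<longleftrightarrow> N (y $ i) \<le> N (y $ j)" for y :: "'a ^ 'n"
  define t where "t c y x = (if C y then transvection i j c x else transvection j i c x)"
    for c and y x :: "'a ^ 'n"
  \<comment> \<open>Each cone is mapped into the other one, so the cone of the image reveals the
    cone of the source, and with it the type of transvection that was applied.\<close>
  have swap: "C (t c y y) \<longleftrightarrow> \<not> C y" if "c \<in> T" "y \<in> Y" for c y
  proof -
    have y: "y $ i \<in> R" "y $ j \<in> R" "y $ i \<noteq> 0 \<or> y $ j \<noteq> 0" "y $ j \<noteq> 0 \<or> y $ i \<noteq> 0"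
      using that unfolding Y_def X_def by auto
    have c: "c \<in> R" "N c > 2" using that T by auto
    show ?thesis
    proof (cases "C y")
      case True
      then show ?thesis
        using transvection_crosses_cone[OF c y(1,2,3)] ij
        by (simp add: t_def C_def transvection_nth)
    next
      case False
      then show ?thesis
        using transvection_crosses_cone[OF c y(2,1,4)] ij
        by (simp add: t_def C_def transvection_nth)
    qed
  qed
  \<comment> \<open>Equal images come from the same cone, so the coordinate left unchanged by the
    transvection is common to \<open>y\<close> and \<open>y'\<close>. The other coordinate then
    separates the parameters.\<close>
  have par: "c = d" if "c \<in> T" "d \<in> T" "y \<in> Y" "y' \<in> Y" and eq: "t c y y = t d y' y'" for c d y y'
  proof -
    have CC: "C y \<longleftrightarrow> C y'"
      using swap[OF \<open>c \<in> T\<close> \<open>y \<in> Y\<close>] swap[OF \<open>d \<in> T\<close> \<open>y' \<in> Y\<close>] eq by simp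
    have y: "y $ i \<in> R" "y' $ i \<in> R" "y $ j \<in> R" "y' $ j \<in> R"
        "y $ i \<noteq> 0 \<or> y $ j \<noteq> 0" "y $ j \<noteq> 0 \<or> y $ i \<noteq> 0"
      using that unfolding Y_def X_def by auto
    have cd: "c \<in> R" "d \<in> R" "c \<noteq> d \<longrightarrow> N (c - d) > 2" using that T by auto
    have e: "t c y y $ i = t d y' y' $ i" "t c y y $ j = t d y' y' $ j" using eq by simp_all
    show "c = d"
    proof (cases "C y")
      case True
      then have "y $ i + c * y $ j = y' $ i + d * y' $ j" "y $ j = y' $ j"
        using e CC ij by (simp_all add: t_def transvection_nth)
      then show ?thesis
        using transvections_separate_cone[OF cd y(1,2,3,5)] True CC by (simp add: C_def)
    next
      case False
      then have "y $ j + c * y $ i = y' $ j + d * y' $ i" "y $ i = y' $ i"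
        using e CC ij by (simp_all add: t_def transvection_nth)
      then show ?thesis
        using transvections_separate_cone[OF cd y(3,4,1,6)] False CC by (simp add: C_def)
    qed
  qed
  have "inj_on (\<lambda>(c, x). t c (\<phi> x) x) (T \<times> X)"
  proof (rule inj_onI, clarify)
    fix c x d x'
    assume m: "c \<in> T" "d \<in> T" "x \<in> X" "x' \<in> X" and eq: "t c (\<phi> x) x = t d (\<phi> x') x'"
    \<comment> \<open>By equivariance, \<open>\<phi>\<close> turns the piecewise map on
      \<open>X\<close> into the one on lattice points, where ping-pong applies.\<close>
    have tr: "\<phi> (t c (\<phi> x) x) = t c (\<phi> x) (\<phi> x)" if "c \<in> T" "x \<in> X" for c x
    proof -
      have "c \<in> R" using that T by auto
      then show ?thesis
        using \<phi>[OF transvection_in_plane_group(1)[OF ij] that(2)]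
          \<phi>[OF transvection_in_plane_group(2)[OF ij] that(2)] by (simp add: t_def)
    qed
    have e: "t c (\<phi> x) (\<phi> x) = t d (\<phi> x') (\<phi> x')" using tr[OF m(1,3)] tr[OF m(2,4)] eq by simp
    then have "c = d" using par[OF m(1,2) \<phi>Y[OF m(3)] \<phi>Y[OF m(4)]] by simp
    moreover have "C (\<phi> x) \<longleftrightarrow> C (\<phi> x')"
      using swap[OF m(1) \<phi>Y[OF m(3)]] swap[OF m(2) \<phi>Y[OF m(4)]] e by simp
    ultimately have "t c (\<phi> x) x = t c (\<phi> x) x'" using eq unfolding t_def by simp
    then have "x = x'" using ij by (cases "C (\<phi> x)") (simp_all add: t_def)
    then show "c = d \<and> x = x'" using \<open>c = d\<close> by simp
  qed
  then show ?thesis unfolding t_def X_def by (rule exI[of _ "\<lambda>x. C (\<phi> x)"])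
qed

end


section \<open>Non-Archimedean valuations\<close>

locale nonarch_valued_field =
  fixes v :: "'a::field \<Rightarrow> real"
  assumes nonarch: "nonarch_valuation v"
begin

lemma v_nonneg [simp]: "0 \<le> v x"
  and v_eq_0_iff [simp]: "v x = 0 \<longleftrightarrow> x = 0"
  and v_mult: "v (x * y) = v x * v y"
  and v_add: "v (x + y) \<le> max (v x) (v y)"
  using nonarch unfolding nonarch_valuation_def by blast+

lemma v_0 [simp]: "v 0 = 0"
  by simp

lemma v_pos: "x \<noteq> 0 \<Longrightarrow> 0 < v x"
  using v_nonneg[of x] v_eq_0_iff[of x] by linarith

lemma v_1 [simp]: "v 1 = 1"
  using v_mult[of 1 1] by simp

lemma v_power: "v (x ^ n) = v x ^ n"
  by (induction n) (simp_all add: v_mult)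

lemma v_minus [simp]: "v (- x) = v x"
proof -
  have "v (- 1) * v (- 1) = 1" using v_mult[of "- 1" "- 1"] by simp
  then have "v (- 1) = 1"
    using v_nonneg[of "- 1"] by (simp add: square_eq_1_iff)
  then show ?thesis using v_mult[of "- 1" x] by simp
qed

lemma v_add_le: "v x \<le> r \<Longrightarrow> v y \<le> r \<Longrightarrow> v (x + y) \<le> r"
  using v_add[of x y] by simp

lemma v_diff_le: "v x \<le> r \<Longrightarrow> v y \<le> r \<Longrightarrow> v (x - y) \<le> r"
  using v_add_le[of x r "- y"] by simp

lemma v_mult_le: "v x \<le> 1 \<Longrightarrow> v y \<le> r \<Longrightarrow> v (x * y) \<le> r"
  using mult_mono[of "v x" 1 "v y" r] by (simp add: v_mult)

lemma v_sum_le: "0 \<le> r \<Longrightarrow> (\<And>i. i \<in> I \<Longrightarrow> v (f i) \<le> r) \<Longrightarrow> v (sum f I) \<le> r"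
  by (induction I rule: infinite_finite_induct) (auto intro: v_add_le)

lemma v_of_int: "v (of_int n) \<le> 1"
  by (induction n rule: int_induct[of _ 0]) (auto intro: v_add_le v_diff_le)

text \<open>This is the closed ball about 0 for \<open>vec_norm\<close>. For
  \<open>r \<ge> 0\<close> the ultrametric inequality makes it a module over the ring of integers,
  hence stable under transvections with integral parameter.\<close>

definition vec_box :: "real \<Rightarrow> ('a ^ 'n::finite) set" where
  "vec_box r = {x. \<forall>k. v (x $ k) \<le> r}"

lemma mem_vec_box: "x \<in> vec_box r \<longleftrightarrow> (\<forall>k. v (x $ k) \<le> r)"
  by (simp add: vec_box_def)

lemma vec_norm_le_iff: "vec_norm v x \<le> r \<longleftrightarrow> x \<in> vec_box r"
  unfolding vec_norm_def mem_vec_box by (subst Max_le_iff) auto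

lemma vec_bounded_imp_subset_box:
  assumes "vec_bounded v A"
  shows "\<exists>\<rho>. A \<subseteq> vec_box \<rho>"
proof -
  interpret Metric_space UNIV "vec_dist v :: 'a ^ 'b \<Rightarrow> 'a ^ 'b \<Rightarrow> real"
    by (rule Metric_space_vec_dist[OF nonarch])
  obtain c r where c: "A \<subseteq> mcball c r"
    using assms unfolding vec_bounded_def mbounded_def by blast
  have "x \<in> vec_box (max (vec_norm v c) r)" if "x \<in> A" for x
  proof -
    have "vec_norm v (c - x) \<le> r" using c that by (auto simp: mcball_def vec_dist_def)
    then have "c - x \<in> vec_box r" by (simp add: vec_norm_le_iff)
    moreover have "c \<in> vec_box (vec_norm v c)" by (simp flip: vec_norm_le_iff)
    ultimately have "v (c $ k - (c - x) $ k) \<le> max (vec_norm v c) r" for k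
      unfolding mem_vec_box by (intro v_diff_le) (simp_all add: max.coboundedI1 max.coboundedI2)
    then show ?thesis by (simp add: mem_vec_box)
  qed
  then show ?thesis by blast
qed

lemma vec_interior_imp_box_translate:
  assumes "vec_interior v A \<noteq> {}"
  shows "\<exists>r>0. \<exists>c. \<forall>x\<in>vec_box r. x + c \<in> A"
proof -
  interpret Metric_space UNIV "vec_dist v :: 'a ^ 'b \<Rightarrow> 'a ^ 'b \<Rightarrow> real"
    by (rule Metric_space_vec_dist[OF nonarch])
  obtain c V where V: "openin mtopology V" "c \<in> V" "V \<subseteq> A"
    using assms unfolding vec_interior_def interior_of_def by blast
  then obtain e where e: "e > 0" "mball c e \<subseteq> V" unfolding openin_mtopology by blast
  have "x + c \<in> A" if "x \<in> vec_box (e / 2)" for x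
  proof -
    have "- x \<in> vec_box (e / 2)" using that by (simp add: mem_vec_box)
    then have "vec_dist v c (x + c) \<le> e / 2" unfolding vec_dist_def vec_norm_le_iff by simp
    then have "x + c \<in> mball c e" using e by (simp add: mball_def)
    then show ?thesis using e V by blast
  qed
  then show ?thesis using e by (intro exI[of _ "e / 2"]) auto
qed

text \<open>Building inverses into the definition avoids cofactor matrices; every special affine map in
  fact belongs to this group.\<close>

definition affine_units :: "('a ^ 'n::finite \<Rightarrow> 'a ^ 'n) set" where
  "affine_units = {f \<in> special_affine v.
     \<exists>h\<in>special_affine v. (\<forall>x. h (f x) = x) \<and> (\<forall>x. f (h x) = x)}"

lemma special_affine_translation: "(\<lambda>x. x + c) \<in> special_affine v"
proof -
  have "mat 1 \<in> special_linear (ring_of_integers v)"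
    by (simp add: special_linear_def ring_of_integers_def mat_def det_I[unfolded mat_def])
  then show ?thesis unfolding special_affine_def by (auto intro!: exI[of _ "mat 1"] exI[of _ c])
qed

lemma special_affine_comp:
  assumes "f \<in> special_affine v" "h \<in> special_affine v"
  shows "(\<lambda>x. f (h x)) \<in> special_affine v"
proof -
  obtain L a M b where L: "L \<in> special_linear (ring_of_integers v)" "f = (\<lambda>x. L *v x + a)"
    and M: "M \<in> special_linear (ring_of_integers v)" "h = (\<lambda>x. M *v x + b)"
    using assms unfolding special_affine_def by auto
  have "v ((L ** M) $ i $ j) \<le> 1" for i j
    using L(1) M(1) by (auto simp: special_linear_def ring_of_integers_def
        matrix_matrix_mult_def intro!: v_sum_le v_mult_le)
  moreover have "det (L ** M) = 1" using L(1) M(1) by (simp add: special_linear_def det_mul)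
  ultimately have "L ** M \<in> special_linear (ring_of_integers v)"
    by (simp add: special_linear_def ring_of_integers_def)
  moreover have "(\<lambda>x. f (h x)) = (\<lambda>x. (L ** M) *v x + (L *v b + a))"
    by (simp add: L(2) M(2) matrix_vector_right_distrib matrix_vector_mul_assoc add.assoc)
  ultimately show ?thesis unfolding special_affine_def by blast
qed

lemma transformation_group_affine_units:
  "transformation_group (affine_units :: ('a ^ 'b::finite \<Rightarrow> 'a ^ 'b) set)"
proof
  show "(\<lambda>x. x) \<in> affine_units"
    unfolding affine_units_def using special_affine_translation[of 0] by auto
next
  fix f g :: "'a ^ 'b \<Rightarrow> 'a ^ 'b"
  assume "f \<in> affine_units" "g \<in> affine_units"
  then obtain f' g' where m: "f \<in> special_affine v" "f' \<in> special_affine v"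
      "g \<in> special_affine v" "g' \<in> special_affine v"
    and inv: "\<forall>x. f' (f x) = x" "\<forall>x. f (f' x) = x" "\<forall>x. g' (g x) = x" "\<forall>x. g (g' x) = x"
    unfolding affine_units_def by blast
  show "(\<lambda>x. f (g x)) \<in> affine_units"
    unfolding affine_units_def
    using special_affine_comp[OF m(1,3)] special_affine_comp[OF m(4,2)] inv
    by (intro CollectI conjI bexI[of _ "\<lambda>x. g' (f' x)"]) simp_all
next
  fix f :: "'a ^ 'b \<Rightarrow> 'a ^ 'b"
  assume "f \<in> affine_units"
  then show "\<exists>h\<in>affine_units. \<forall>x. h (f x) = x" unfolding affine_units_def by blast
qed

lemma translation_in_affine_units: "(\<lambda>x. x + c) \<in> affine_units"
  unfolding affine_units_def
  by (intro CollectI conjI bexI[of _ "\<lambda>x. x + - c"] special_affine_translation) auto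

lemma transvection_in_affine_units:
  assumes ij: "i \<noteq> j" and c: "v c \<le> 1"
  shows "transvection i j c \<in> affine_units"
proof -
  have t: "transvection i j c \<in> special_affine v" if c: "v c \<le> 1" for c
  proof -
    \<comment> \<open>The elementary matrix is written as a row operation on the identity, in the
      shape that \<open>det_row_operation\<close> expects.\<close>
    define L :: "'a ^ 'b ^ 'b" where
      "L = (\<chi> k. if k = i then row i (mat 1) + c *s row j (mat 1) else row k (mat 1))"
    have "det L = 1"
      unfolding L_def using det_row_operation[OF ij, of "mat 1" c] by simp
    moreover have "v (L $ k $ l) \<le> 1" for k l
      using c by (auto simp: L_def row_def mat_def intro: v_add_le)
    ultimately have "L \<in> special_linear (ring_of_integers v)"
      by (simp add: special_linear_def ring_of_integers_def)
    moreover have "transvection i j c = (\<lambda>x. L *v x + 0)"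
    proof
      fix x
      have m: "(\<Sum>l\<in>UNIV. (mat 1 :: 'a ^ 'b ^ 'b) $ k $ l * x $ l) = x $ k" for k
      proof -
        have "((mat 1 :: 'a ^ 'b ^ 'b) *v x) $ k = x $ k" by simp
        then show ?thesis by (simp only: matrix_vector_mult_def vec_lambda_beta)
      qed
      have "(L *v x) $ k = transvection i j c x $ k" for k
      proof (cases "k = i")
        case True
        then have "(L *v x) $ k = (\<Sum>l\<in>UNIV. (mat 1 :: 'a ^ 'b ^ 'b) $ i $ l * x $ l
            + c * ((mat 1 :: 'a ^ 'b ^ 'b) $ j $ l * x $ l))"
          by (simp add: L_def row_def matrix_vector_mult_def distrib_right mult.assoc)
        then show ?thesis
          using True by (simp only: sum.distrib m transvection_nth refl if_True flip: sum_distrib_left)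
      next
        case False
        then have "(L *v x) $ k = (\<Sum>l\<in>UNIV. (mat 1 :: 'a ^ 'b ^ 'b) $ k $ l * x $ l)"
          by (simp add: L_def row_def matrix_vector_mult_def)
        then show ?thesis using False by (simp only: m transvection_nth if_False)
      qed
      then show "transvection i j c x = L *v x + 0" by (simp add: vec_eq_iff)
    qed
    ultimately show ?thesis unfolding special_affine_def by blast
  qed
  show ?thesis
    unfolding affine_units_def using t[of c] t[of "- c"] c
      transvection_inverse[OF ij, of c] transvection_inverse[OF ij, of "- c"]
    by (intro CollectI conjI bexI[of _ "transvection i j (- c)"]) auto
qed

end

section \<open>Finite covers of boxes by translates of smaller boxes\<close>

locale local_field_like = nonarch_valued_field +
  assumes discrete: "discrete_valuation v" and finite_residue: "finite (residue_field v)"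
begin

lemma uniformizer_exists: "\<exists>\<pi>. 0 < v \<pi> \<and> v \<pi> < 1 \<and> (\<forall>x. v x < 1 \<longrightarrow> v x \<le> v \<pi>)"
proof -
  obtain r where r: "r \<in> value_group v" "0 < r" "r < 1"
    and max: "\<forall>s\<in>value_group v \<inter> {0<..<1}. s \<le> r"
    using discrete unfolding discrete_valuation_def by auto
  obtain \<pi> where \<pi>: "v \<pi> = r" using r unfolding value_group_def by auto
  have "v x \<le> r" if "v x < 1" for x
  proof (cases "x = 0")
    case False
    then have "v x \<in> value_group v \<inter> {0<..<1}" using that v_pos by (auto simp: value_group_def)
    then show ?thesis using max by blast
  qed (use r in simp)
  then show ?thesis using \<pi> r by (intro exI[of _ \<pi>]) simp
qed

lemma residue_representatives:
  obtains T where "finite T" "\<And>x. v x \<le> 1 \<Longrightarrow> \<exists>t\<in>T. v (x - t) < 1"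
proof -
  define rel where "rel = {(x, y). x \<in> ring_of_integers v \<and> y \<in> ring_of_integers v \<and>
    x - y \<in> maximal_ideal v}"
  define T where "T = (\<lambda>c. SOME y. y \<in> c) ` residue_field v"
  show ?thesis
  proof
    show "finite T" unfolding T_def using finite_residue by simp
    fix x assume x: "v x \<le> 1"
    have "x \<in> rel `` {x}"
      using x by (simp add: rel_def ring_of_integers_def maximal_ideal_def)
    then have "(SOME y. y \<in> rel `` {x}) \<in> rel `` {x}" by (rule someI)
    then have "(x, SOME y. y \<in> rel `` {x}) \<in> rel" by (rule Image_singleton_iff[THEN iffD1])
    then have "v (x - (SOME y. y \<in> rel `` {x})) < 1"
      unfolding rel_def maximal_ideal_def by blast
    moreover have "rel `` {x} \<in> residue_field v"
      unfolding residue_field_def rel_def[symmetric]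
      using x by (intro quotientI) (simp add: ring_of_integers_def)
    ultimately show "\<exists>t\<in>T. v (x - t) < 1" unfolding T_def by blast
  qed
qed

text \<open>Integral elements are expanded in powers of a uniformizer with digits from a finite set
  of residue representatives: \<open>m\<close> digits leave an error of at most
  \<open>v \<pi> ^ m\<close>. Other radii are reduced to the integral case by scaling with a power
  of \<open>\<pi>\<close>.\<close>

lemma finite_net:
  assumes "0 < r"
  obtains T where "finite T" "\<And>x. v x \<le> \<rho> \<Longrightarrow> \<exists>t\<in>T. v (x - t) \<le> r"
proof -
  obtain \<pi> where \<pi>: "0 < v \<pi>" "v \<pi> < 1" and max: "\<And>x. v x < 1 \<Longrightarrow> v x \<le> v \<pi>"
    using uniformizer_exists by blast
  have \<pi>0: "\<pi> \<noteq> 0" using \<pi> by auto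
  obtain T0 where T0: "finite T0" "\<And>x. v x \<le> 1 \<Longrightarrow> \<exists>t\<in>T0. v (x - t) < 1"
    using residue_representatives by blast
  have net: "\<exists>T. finite T \<and> (\<forall>x. v x \<le> 1 \<longrightarrow> (\<exists>t\<in>T. v (x - t) \<le> v \<pi> ^ m))" for m
  proof (induction m)
    case 0
    then show ?case by (intro exI[of _ "{0}"]) auto
  next
    case (Suc m)
    then obtain T where T: "finite T" "\<And>x. v x \<le> 1 \<Longrightarrow> \<exists>t\<in>T. v (x - t) \<le> v \<pi> ^ m" by blast
    have "\<exists>u\<in>(\<lambda>(s, t). s + \<pi> * t) ` (T0 \<times> T). v (x - u) \<le> v \<pi> ^ Suc m" if x: "v x \<le> 1" for x
    proof -
      obtain s where s: "s \<in> T0" "v (x - s) < 1" using T0 x by blast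
      define y where "y = (x - s) / \<pi>"
      have y: "x - s = \<pi> * y" using \<pi>0 by (simp add: y_def)
      \<comment> \<open>Discreteness enters here: a value below 1 is at most \<open>v \<pi>\<close>,
        so the remainder \<open>x - s\<close> is divisible by \<open>\<pi>\<close> with integral
        quotient.\<close>
      have "v \<pi> * v y \<le> v \<pi>" using max[OF s(2)] by (simp add: y v_mult)
      then have "v y \<le> 1" using \<pi> by simp
      then obtain t where t: "t \<in> T" "v (y - t) \<le> v \<pi> ^ m" using T by blast
      have "x - (s + \<pi> * t) = \<pi> * (y - t)" using y by (simp add: algebra_simps)
      then have "v (x - (s + \<pi> * t)) = v \<pi> * v (y - t)" by (simp add: v_mult)
      also have "\<dots> \<le> v \<pi> ^ Suc m" using t \<pi> by simp
      finally show ?thesis using s t by (intro bexI[of _ "s + \<pi> * t"]) auto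
    qed
    then show ?case using T(1) T0(1) by (intro exI[of _ "(\<lambda>(s, t). s + \<pi> * t) ` (T0 \<times> T)"]) auto
  qed
  \<comment> \<open>The maximum with 1 keeps the bound meaningful when \<open>\<rho>\<close> is
    small or negative. Multiplication by \<open>p = \<pi> ^ M\<close> then carries the ball of
    radius \<open>\<rho>\<close> into the ring of integers.\<close>
  have "0 < 1 / max \<rho> 1" by (simp add: less_max_iff_disj)
  then obtain M where M: "v \<pi> ^ M < 1 / max \<rho> 1"
    using real_arch_pow_inv \<pi>(2) by blast
  define p where "p = \<pi> ^ M"
  have p: "p \<noteq> 0" "0 < v p" "v p < 1 / max \<rho> 1" using \<pi> \<pi>0 M by (auto simp: p_def v_power)
  have \<rho>: "\<rho> * v p \<le> 1"
  proof -
    have "\<rho> * v p \<le> max \<rho> 1 * v p" using p by (intro mult_right_mono) auto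
    also have "\<dots> \<le> 1" using p by (simp add: field_simps max_def split: if_splits)
    finally show ?thesis .
  qed
  \<comment> \<open>Dividing by \<open>p\<close> at the end enlarges the error by the factor
    \<open>1 / v p\<close>, which explains the precision \<open>r * v p\<close>.\<close>
  obtain m where m: "v \<pi> ^ m < r * v p"
    using real_arch_pow_inv[of "r * v p" "v \<pi>"] \<pi> p assms by auto
  obtain T where T: "finite T" "\<And>x. v x \<le> 1 \<Longrightarrow> \<exists>t\<in>T. v (x - t) \<le> v \<pi> ^ m"
    using net by blast
  show ?thesis
  proof
    show "finite ((\<lambda>t. t / p) ` T)" using T by simp
    fix x assume "v x \<le> \<rho>"
    then have "v x * v p \<le> \<rho> * v p" using p by (intro mult_right_mono) auto
    then have "v (x * p) \<le> 1" using \<rho> by (simp add: v_mult)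
    then obtain t where t: "t \<in> T" "v (x * p - t) \<le> v \<pi> ^ m" using T by blast
    have "(x - t / p) * p = x * p - t" using p by (simp add: field_simps)
    then have "v (x - t / p) * v p \<le> r * v p" using t m by (metis less_imp_le order.trans v_mult)
    then have "v (x - t / p) \<le> r" using p by simp
    then show "\<exists>t\<in>(\<lambda>t. t / p) ` T. v (x - t) \<le> r" using t by blast
  qed
qed

lemma finite_box_cover:
  assumes "0 < r"
  obtains T :: "('a ^ 'n::finite) set"
  where "finite T" "\<And>x. x \<in> vec_box \<rho> \<Longrightarrow> \<exists>t\<in>T. x - t \<in> vec_box r"
proof -
  obtain S where S: "finite S" "\<And>x. v x \<le> \<rho> \<Longrightarrow> \<exists>t\<in>S. v (x - t) \<le> r"
    using finite_net[OF assms] by blast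
  show ?thesis
  proof
    show "finite (vec_lambda ` (UNIV \<rightarrow>\<^sub>E S) :: ('a ^ 'n) set)"
      using S by (intro finite_imageI finite_PiE) auto
    fix x :: "'a ^ 'n" assume "x \<in> vec_box \<rho>"
    then have "\<forall>k. \<exists>t. t \<in> S \<and> v (x $ k - t) \<le> r" using S by (auto simp: mem_vec_box)
    then obtain t where t: "\<forall>k. t k \<in> S \<and> v (x $ k - t k) \<le> r" by metis
    then have "x - vec_lambda t \<in> vec_box r" by (simp add: mem_vec_box)
    then show "\<exists>t\<in>vec_lambda ` (UNIV \<rightarrow>\<^sub>E S). x - t \<in> vec_box r"
      using t by (intro bexI[of _ "vec_lambda t"]) auto
  qed
qed

section \<open>Disjoint copies of a box inside itself\<close>

lemma box_self_duplicating:
  assumes ij: "(i::'n::finite) \<noteq> j" and r: "0 < r"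
    and R: "normed_subring R N" "R \<subseteq> ring_of_integers v"
    and cd: "c \<in> R" "d \<in> R" "N c > 2" "N d > 2" "N (c - d) > 2" "N (d - c) > 2"
  obtains f\<^sub>0 f\<^sub>1 :: "'a ^ 'n \<Rightarrow> 'a ^ 'n"
  where "piecewise affine_units (vec_box r) f\<^sub>0" "piecewise affine_units (vec_box r) f\<^sub>1"
    "f\<^sub>0 ` vec_box r \<subseteq> vec_box r" "f\<^sub>1 ` vec_box r \<subseteq> vec_box r"
    "inj_on f\<^sub>0 (vec_box r)" "inj_on f\<^sub>1 (vec_box r)" "f\<^sub>0 ` vec_box r \<inter> f\<^sub>1 ` vec_box r = {}"
proof -
  interpret normed_subring R N by (rule R(1))
  interpret transformation_group "affine_units :: ('a ^ 'n \<Rightarrow> 'a ^ 'n) set"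
    by (rule transformation_group_affine_units)
  have "c \<noteq> d" using cd norm_eq_0_iff[OF zero_mem] by auto
  define X :: "('a ^ 'n) set" where "X = {x. x $ i \<noteq> 0 \<or> x $ j \<noteq> 0}"
  obtain P where inj: "inj_on (\<lambda>(c, x). if P x then transvection i j c x else transvection j i c x)
    ({c, d} \<times> X)"
  proof -
    have "\<exists>P. inj_on (\<lambda>(c, x :: 'a ^ 'n). if P x then transvection i j c x else transvection j i c x)
        ({c, d} \<times> X)"
      using cd unfolding X_def by (intro plane_paradox[OF ij]) auto
    then show ?thesis using that by (elim exE)
  qed
  define F where "F c x = (if P x then transvection i j c x else transvection j i c x)" for c x
  have F_inj: "a = b \<and> x = y"
    if "F a x = F b y" "a \<in> {c, d}" "b \<in> {c, d}" "x \<in> X" "y \<in> X" for a b x y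
    using inj_onD[OF inj, of "(a, x)" "(b, y)"] that unfolding F_def by auto
  have v1: "v a \<le> 1" if "a \<in> {c, d}" for a using that cd R(2) by (auto simp: ring_of_integers_def)
  have F_mem: "F a x \<in> vec_box r \<inter> X" if "a \<in> {c, d}" "x \<in> vec_box r \<inter> X" for a x
    using that ij v1[OF that(1)]
    by (auto simp: F_def X_def mem_vec_box transvection_nth intro!: v_add_le v_mult_le)
  have F_pw: "piecewise affine_units (vec_box r \<inter> X) (F a)" if "a \<in> {c, d}" for a
    unfolding F_def[abs_def] using ij v1[OF that]
    by (intro piecewise_If piecewise_single transvection_in_affine_units) auto

  obtain \<pi> where \<pi>: "0 < v \<pi>" "v \<pi> < 1" using uniformizer_exists by blast
  obtain m where "v \<pi> ^ m < r" using real_arch_pow_inv[OF r \<pi>(2)] by blast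
  \<comment> \<open>Any nonzero \<open>z\<close> of value at most \<open>r\<close> serves:
    translating coordinate \<open>i\<close> by it leaves the box invariant and moves the locus
    outside \<open>X\<close> into \<open>X\<close>.\<close>
  define z where "z = \<pi> ^ m"
  have z: "z \<noteq> 0" "v z \<le> r" using \<pi> \<open>v \<pi> ^ m < r\<close> by (auto simp: z_def v_power)
  define s where "s x = x + axis i z" for x :: "'a ^ 'n"
  have s_mem: "s x \<in> vec_box r \<inter> X" if "x \<in> vec_box r" "x \<notin> X" for x
    using that z by (auto simp: s_def X_def mem_vec_box axis_def intro!: v_add_le)

  \<comment> \<open>This injects the whole box into its part in \<open>X\<close>: that part goes to
    the copy of \<open>c\<close>, the remaining locus is first translated into \<open>X\<close> and
    goes to the copy of \<open>d\<close>. Following \<open>e\<close> by \<open>F c\<close> and by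
    \<open>F d\<close> then gives two disjoint copies of the whole box.\<close>
  define e where "e x = (if x \<in> X then F c x else F d (s x))" for x
  have e_mem: "e ` vec_box r \<subseteq> vec_box r \<inter> X"
    unfolding e_def using F_mem s_mem by auto
  have e_inj: "inj_on e (vec_box r)"
  proof (rule inj_onI)
    fix x y assume x: "x \<in> vec_box r" and y: "y \<in> vec_box r" and "e x = e y"
    then have "F (if x \<in> X then c else d) (if x \<in> X then x else s x) =
        F (if y \<in> X then c else d) (if y \<in> X then y else s y)"
      unfolding e_def by (simp split: if_splits)
    then have "(if x \<in> X then c else d) = (if y \<in> X then c else d) \<and>
        (if x \<in> X then x else s x) = (if y \<in> X then y else s y)"
      by (rule F_inj) (use s_mem x y in auto)
    then show "x = y" using \<open>c \<noteq> d\<close> by (simp add: s_def split: if_splits)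
  qed
  have "piecewise affine_units {x \<in> vec_box r. x \<notin> X} (\<lambda>x. F d (s x))"
  proof (rule piecewise_comp[where f = s and h = "F d" and B = "vec_box r \<inter> X"])
    show "piecewise affine_units {x \<in> vec_box r. x \<notin> X} s"
      unfolding s_def[abs_def] by (intro piecewise_single translation_in_affine_units)
    show "s ` {x \<in> vec_box r. x \<notin> X} \<subseteq> vec_box r \<inter> X" using s_mem by auto
  qed (simp add: F_pw)
  moreover have "piecewise affine_units {x \<in> vec_box r. x \<in> X} (F c)"
    by (rule piecewise_subset[OF F_pw]) auto
  ultimately have e_pw: "piecewise affine_units (vec_box r) e"
    unfolding e_def[abs_def] by (intro piecewise_If)

  show ?thesis
  proof (rule that[of "\<lambda>x. F c (e x)" "\<lambda>x. F d (e x)"])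
    show "piecewise affine_units (vec_box r) (\<lambda>x. F c (e x))"
      "piecewise affine_units (vec_box r) (\<lambda>x. F d (e x))"
      using piecewise_comp[OF e_pw e_mem F_pw[of c]] piecewise_comp[OF e_pw e_mem F_pw[of d]]
      by simp_all
    show "(\<lambda>x. F c (e x)) ` vec_box r \<subseteq> vec_box r" "(\<lambda>x. F d (e x)) ` vec_box r \<subseteq> vec_box r"
      using F_mem[of c] F_mem[of d] e_mem by blast+
    have Fe_inj: "a = b \<and> x = y" if "F a (e x) = F b (e y)" "a \<in> {c, d}" "b \<in> {c, d}"
      "x \<in> vec_box r" "y \<in> vec_box r" for a b x y
    proof -
      have "e x \<in> X" "e y \<in> X" using e_mem that(4,5) by blast+
      then have "a = b \<and> e x = e y" by (rule F_inj[OF that(1-3)])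
      then show ?thesis using inj_onD[OF e_inj _ that(4,5)] by simp
    qed
    show "inj_on (\<lambda>x. F c (e x)) (vec_box r)" "inj_on (\<lambda>x. F d (e x)) (vec_box r)"
      by (rule inj_onI, drule Fe_inj, simp_all)+
    show "(\<lambda>x. F c (e x)) ` vec_box r \<inter> (\<lambda>x. F d (e x)) ` vec_box r = {}"
    proof (rule ccontr)
      assume "\<not> ?thesis"
      then obtain x y where "x \<in> vec_box r" "y \<in> vec_box r" "F c (e x) = F d (e y)" by blast
      then show False using Fe_inj[of c x d y] \<open>c \<noteq> d\<close> by simp
    qed
  qed
qed

text \<open>Disjointness of the images of \<open>f\<^sub>0\<close> and \<open>f\<^sub>1\<close> makes the maps
  \<open>f\<^sub>1\<^sup>k \<circ> f\<^sub>0\<close> jointly injective, which yields arbitrarily many disjoint copies.\<close>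

lemma box_embeds_into_smaller_box:
  assumes ij: "(i::'n::finite) \<noteq> j" and r: "0 < r"
    and R: "normed_subring R N" "R \<subseteq> ring_of_integers v"
    and cd: "c \<in> R" "d \<in> R" "N c > 2" "N d > 2" "N (c - d) > 2" "N (d - c) > 2"
  obtains f :: "'a ^ 'n \<Rightarrow> 'a ^ 'n"
  where "piecewise affine_units (vec_box \<rho>) f" "f ` vec_box \<rho> \<subseteq> vec_box r" "inj_on f (vec_box \<rho>)"
proof -
  interpret transformation_group "affine_units :: ('a ^ 'n \<Rightarrow> 'a ^ 'n) set"
    by (rule transformation_group_affine_units)
  define U :: "('a ^ 'n) set" where "U = vec_box r"
  obtain f\<^sub>0 f\<^sub>1 :: "'a ^ 'n \<Rightarrow> 'a ^ 'n"
    where pw: "piecewise affine_units U f\<^sub>0" "piecewise affine_units U f\<^sub>1"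
      and im: "f\<^sub>0 ` U \<subseteq> U" "f\<^sub>1 ` U \<subseteq> U" and inj: "inj_on f\<^sub>0 U" "inj_on f\<^sub>1 U"
      and disj: "f\<^sub>0 ` U \<inter> f\<^sub>1 ` U = {}"
    using box_self_duplicating[OF ij r R cd] unfolding U_def by blast
  define q where "q k x = (f\<^sub>1 ^^ k) (f\<^sub>0 x)" for k x
  have q_0: "q 0 x = f\<^sub>0 x" and q_Suc: "q (Suc k) x = f\<^sub>1 (q k x)" for k x
    by (simp_all add: q_def)
  have q_im: "q k ` U \<subseteq> U" for k
    by (induction k) (use im in \<open>auto simp: q_0 q_Suc image_subset_iff\<close>)
  have q_pw: "piecewise affine_units U (q k)" for k
  proof (induction k)
    case 0
    have "q 0 = f\<^sub>0" by (simp add: fun_eq_iff q_0)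
    then show ?case using pw by simp
  next
    case (Suc k)
    have "q (Suc k) = (\<lambda>x. f\<^sub>1 (q k x))" by (simp add: fun_eq_iff q_Suc)
    then show ?case using piecewise_comp[OF Suc q_im pw(2)] by simp
  qed
  \<comment> \<open>An image of \<open>f\<^sub>0\<close> never equals an image of
    \<open>f\<^sub>1\<close>, so both sides have the same number of outer applications of
    \<open>f\<^sub>1\<close>, and these are cancelled one by one.\<close>
  have q_inj: "k = l \<and> x = y" if "x \<in> U" "y \<in> U" "q k x = q l y" for k l x y
    using that(3)
  proof (induction k arbitrary: l)
    case 0
    show ?case
    proof (cases l)
      case 0
      then show ?thesis using "0.prems" that(1,2) inj_onD[OF inj(1)] by (simp add: q_0)
    next
      case (Suc l')
      then show ?thesis using "0.prems" that(1,2) q_im[of l'] disj by (auto simp: q_0 q_Suc)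
    qed
  next
    case (Suc k)
    show ?case
    proof (cases l)
      case 0
      then show ?thesis using Suc.prems that(1,2) q_im[of k] disj by (auto simp: q_0 q_Suc)
    next
      case (Suc l')
      moreover have "q k x \<in> U" "q l' y \<in> U" using that(1,2) q_im by blast+
      ultimately have "q k x = q l' y" using Suc.prems inj(2) by (auto simp: q_Suc dest: inj_onD)
      then show ?thesis using Suc Suc.IH by blast
    qed
  qed

  obtain T :: "('a ^ 'n) set" where T: "finite T" "\<And>x. x \<in> vec_box \<rho> \<Longrightarrow> \<exists>t\<in>T. x - t \<in> U"
    using finite_box_cover[OF r] unfolding U_def by blast
  \<comment> \<open>Numbering the finitely many centres assigns to each centre \<open>t\<close> its
    own copy \<open>q (h t)\<close> of the small box. A point is recentred by its chosen centre and
    put into that copy, from which both the centre and the difference can be read off.\<close>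
  obtain h :: "'a ^ 'n \<Rightarrow> nat" where h: "inj_on h T"
    using finite_imp_inj_to_nat_seg[OF T(1)] by blast
  have "\<exists>\<tau>. \<forall>x\<in>vec_box \<rho>. \<tau> x \<in> T \<and> x - \<tau> x \<in> U"
    using T(2) by (intro bchoice) blast
  then obtain \<tau> where \<tau>: "\<And>x. x \<in> vec_box \<rho> \<Longrightarrow> \<tau> x \<in> T" "\<And>x. x \<in> vec_box \<rho> \<Longrightarrow> x - \<tau> x \<in> U"
    by blast
  show ?thesis
  proof (rule that[of "\<lambda>x. q (h (\<tau> x)) (x + - \<tau> x)"])
    show "piecewise affine_units (vec_box \<rho>) (\<lambda>x. q (h (\<tau> x)) (x + - \<tau> x))"
    proof (rule piecewise_choice[where f = "\<lambda>t x. q (h t) (x + - t)", OF T(1)])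
      show "\<tau> ` vec_box \<rho> \<subseteq> T" using \<tau> by blast
      fix t
      have "(\<lambda>x. x + - t) ` {x \<in> vec_box \<rho>. \<tau> x = t} \<subseteq> U" using \<tau> by auto
      then show "piecewise affine_units {x \<in> vec_box \<rho>. \<tau> x = t} (\<lambda>x. q (h t) (x + - t))"
        by (rule piecewise_comp[OF piecewise_single[OF translation_in_affine_units] _ q_pw])
    qed
    show "(\<lambda>x. q (h (\<tau> x)) (x + - \<tau> x)) ` vec_box \<rho> \<subseteq> vec_box r"
      using \<tau>(2) q_im unfolding U_def by (simp add: image_subset_iff)
    show "inj_on (\<lambda>x. q (h (\<tau> x)) (x + - \<tau> x)) (vec_box \<rho>)"
    proof (rule inj_onI)
      fix x y assume x: "x \<in> vec_box \<rho>" and y: "y \<in> vec_box \<rho>"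
        and "q (h (\<tau> x)) (x + - \<tau> x) = q (h (\<tau> y)) (y + - \<tau> y)"
      then have "h (\<tau> x) = h (\<tau> y) \<and> x + - \<tau> x = y + - \<tau> y"
        using \<tau>(2) by (intro q_inj) auto
      then show "x = y" using inj_onD[OF h] \<tau>(1) x y by fastforce
    qed
  qed
qed

section \<open>Normed subrings of the ring of integers\<close>

lemma normed_subring_char_0:
  assumes inj: "inj (of_int :: int \<Rightarrow> 'a)"
  obtains R N c d where "normed_subring R N" "R \<subseteq> ring_of_integers v"
    "c \<in> R" "d \<in> R" "N c > 2" "N d > 2" "N (c - d) > 2" "N (d - c) > (2::real)"
proof -
  define N where "N x = real_of_int \<bar>inv of_int x\<bar>" for x :: 'a
  have N: "N (of_int n) = real_of_int \<bar>n\<bar>" for n by (simp add: N_def inv_f_f[OF inj])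
  have "normed_subring \<int> N"
  proof
    fix x y :: 'a assume "x \<in> \<int>" "y \<in> \<int>"
    then obtain m n where mn: "x = of_int m" "y = of_int n" by (auto elim!: Ints_cases)
    show "0 \<le> N x" by (simp add: mn N)
    show "N x = 0 \<longleftrightarrow> x = 0" using inj_eq[OF inj, of m 0] by (simp add: mn N)
    show "N (x * y) = N x * N y" using N[of "m * n"] by (simp add: mn N abs_mult)
    show "N (x - y) \<le> N x + N y" using N[of "m - n"] by (simp add: mn N)
  qed auto
  moreover have "\<int> \<subseteq> ring_of_integers v"
    using v_of_int by (auto simp: ring_of_integers_def elim!: Ints_cases)
  \<comment> \<open>The integers 3 and 6 and their difference all have absolute value above 2, as
    ping-pong demands.\<close>
  moreover have "N (of_int 3) > 2" "N (of_int 6) > 2" "N (of_int 3 - of_int 6) > 2"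
      "N (of_int 6 - of_int 3) > 2"
    using N[of 3] N[of 6] N[of "3 - 6"] N[of "6 - 3"] unfolding of_int_diff by simp_all
  ultimately show ?thesis using that[of \<int> N "of_int 3" "of_int 6"] Ints_of_int by blast
qed

text \<open>Nonzero elements of the finite prime ring \<open>\<int>\<close> have valuation 1, so an element with valuation
  strictly between 0 and 1 is transcendental over it.\<close>

lemma normed_subring_char_p:
  assumes "\<not> inj (of_int :: int \<Rightarrow> 'a)"
  obtains R N c d where "normed_subring R N" "R \<subseteq> ring_of_integers v"
    "c \<in> R" "d \<in> R" "N c > 2" "N d > 2" "N (c - d) > 2" "N (d - c) > (2::real)"
proof -
  obtain a b :: int where "(of_int a :: 'a) = of_int b" "a < b"
    using assms unfolding inj_def by (metis linorder_neqE)
  \<comment> \<open>This is just some positive integer that vanishes in the field, not necessarily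
    the characteristic; it suffices to make the image of the integers finite.\<close>
  define p where "p = b - a"
  have p: "p > 0" "(of_int p :: 'a) = 0"
    using \<open>a < b\<close> \<open>of_int a = of_int b\<close> by (simp_all add: p_def)
  have "x \<in> of_int ` {0..<p}" if "x \<in> \<int>" for x :: 'a
  proof -
    obtain n where "x = of_int n" using \<open>x \<in> \<int>\<close> by (rule Ints_cases)
    also have "\<dots> = of_int (p * (n div p) + n mod p)" by simp
    also have "\<dots> = of_int (n mod p)" unfolding of_int_add of_int_mult using p by simp
    finally show ?thesis using p by auto
  qed
  then have fin: "finite (\<int> :: 'a set)" using finite_subset[of \<int> "of_int ` {0..<p}"] by blast
  have v_Ints: "v x = 1" if x: "x \<in> \<int>" "x \<noteq> 0" for x
  proof -
    \<comment> \<open>Powers of a nonzero element of a finite ring inside a field repeat, so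
      \<open>x\<close> is a root of unity and has value 1.\<close>
    have "range (\<lambda>k. x ^ k) \<subseteq> \<int>" using x by auto
    then have "\<not> inj (\<lambda>k. x ^ k)" using fin finite_subset range_inj_infinite by blast
    then obtain k l :: nat where "x ^ k = x ^ l" "k < l" unfolding inj_def by (metis linorder_neqE)
    then have "x ^ (l - k) = 1" using x by (simp add: power_diff)
    then have "v x ^ (l - k) = 1" using v_power[of x "l - k"] by simp
    then show ?thesis using \<open>k < l\<close> power_eq_1_iff[of "v x" "l - k"] by simp
  qed
  obtain \<pi> where \<pi>: "0 < v \<pi>" "v \<pi> < 1" using uniformizer_exists by blast
  define Q where "Q = {P :: 'a poly. \<forall>k. coeff P k \<in> \<int>}"
  have Q_pCons: "pCons a P \<in> Q \<longleftrightarrow> a \<in> \<int> \<and> P \<in> Q" for a P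
    unfolding Q_def by (auto simp: coeff_pCons split: nat.splits)
  have v_le: "v (poly P \<pi>) \<le> 1" if "P \<in> Q" for P
    using that
  proof (induction P)
    case (pCons a P)
    then have "a \<in> \<int>" "v (poly P \<pi>) \<le> 1" by (simp_all add: Q_pCons)
    then have "v a \<le> 1" "v (\<pi> * poly P \<pi>) \<le> 1"
      using v_Ints[of a] \<pi> v_mult_le[of \<pi> "poly P \<pi>" 1] by (cases "a = 0"; simp)+
    then show ?case by (simp add: v_add_le)
  qed simp
  \<comment> \<open>A vanishing constant term allows a factor \<open>\<pi>\<close> to be split off.
    Otherwise the constant term has value 1 and cannot cancel the remaining terms, whose sum has
    value below 1.\<close>
  have nz: "poly P \<pi> \<noteq> 0" if "P \<in> Q" "P \<noteq> 0" for P
    using that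
  proof (induction P)
    case (pCons a P)
    then have P: "a \<in> \<int>" "P \<in> Q" by (simp_all add: Q_pCons)
    show ?case
    proof (cases "a = 0")
      case True
      then show ?thesis using pCons P \<pi> by auto
    next
      case False
      have "v (\<pi> * poly P \<pi>) \<le> v \<pi> * 1"
        unfolding v_mult using v_le[OF P(2)] by (intro mult_left_mono) simp_all
      then have "v (\<pi> * poly P \<pi>) < 1" using \<pi> by simp
      moreover have "v a = 1" using v_Ints P False by simp
      ultimately show ?thesis using v_minus[of a] by (auto simp: add_eq_0_iff)
    qed
  qed simp
  have Q_diff: "P - P' \<in> Q" and Q_mult: "P * P' \<in> Q" if "P \<in> Q" "P' \<in> Q" for P P'
    using that unfolding Q_def by (auto simp: coeff_mult)
  \<comment> \<open>Injectivity of evaluation at \<open>\<pi>\<close> makes the degree of the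
    polynomial well defined on its values, so that it yields a norm on \<open>R\<close>.\<close>
  have inj: "inj_on (\<lambda>P. poly P \<pi>) Q"
  proof (rule inj_onI)
    fix P P' assume "P \<in> Q" "P' \<in> Q" "poly P \<pi> = poly P' \<pi>"
    then show "P = P'" using nz[OF Q_diff, of P P'] by auto
  qed
  \<comment> \<open>The base 3 puts every nonconstant polynomial above the threshold 2. The value 0
    at the zero polynomial is set separately, since its \<open>degree\<close> is 0 by
    convention.\<close>
  define deg where "deg P = (if P = 0 then 0 else 3 ^ degree P :: real)" for P :: "'a poly"
  have deg_mult: "deg (P * P') = deg P * deg P'" for P P'
    by (simp add: deg_def degree_mult_eq power_add)
  have deg_diff: "deg (P - P') \<le> deg P + deg P'" for P P'
  proof (cases "P = 0 \<or> P' = 0")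
    case False
    have "deg (P - P') \<le> 3 ^ degree (P - P')" by (simp add: deg_def)
    also have "\<dots> \<le> 3 ^ max (degree P) (degree P')"
      by (intro power_increasing degree_diff_le_max) simp
    also have "\<dots> \<le> deg P + deg P'" using False by (auto simp: deg_def max_def)
    finally show ?thesis .
  qed (auto simp: deg_def)
  define R where "R = (\<lambda>P. poly P \<pi>) ` Q"
  define N where "N x = deg (inv_into Q (\<lambda>P. poly P \<pi>) x)" for x
  have N: "N (poly P \<pi>) = deg P" if "P \<in> Q" for P
    unfolding N_def using inv_into_f_f[OF inj that] by simp
  have "normed_subring R N"
  proof
    have "1 \<in> Q" by (simp add: Q_def)
    then show "1 \<in> R" unfolding R_def by (rule rev_image_eqI) simp
    fix x y assume "x \<in> R" "y \<in> R"
    then obtain P P' where P: "P \<in> Q" "x = poly P \<pi>" and P': "P' \<in> Q" "y = poly P' \<pi>"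
      unfolding R_def by blast
    have d: "x - y = poly (P - P') \<pi>" and m: "x * y = poly (P * P') \<pi>" by (simp_all add: P P')
    show "x - y \<in> R" "x * y \<in> R" unfolding d m R_def using P P' Q_diff Q_mult by blast+
    show "0 \<le> N x" using P by (simp add: N deg_def)
    show "N x = 0 \<longleftrightarrow> x = 0" using P nz[of P] by (auto simp: N deg_def)
    show "N (x * y) = N x * N y" unfolding m using P P' by (simp only: N Q_mult deg_mult)
    show "N (x - y) \<le> N x + N y" unfolding d using P P' by (simp only: N Q_diff deg_diff)
  qed
  moreover have "R \<subseteq> ring_of_integers v"
    using v_le unfolding R_def by (auto simp: ring_of_integers_def)
  ultimately show ?thesis
  proof (rule that)
    \<comment> \<open>The parameters are \<open>\<pi>\<close> and its square. As polynomials they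
      have degrees 1 and 2, and their difference has degree 2, so all the required sizes are 3 or
      9.\<close>
    define c where "c = [:0, 1 :: 'a:]"
    define d where "d = [:0, 0, 1 :: 'a:]"
    have "c \<in> Q" "d \<in> Q"
      unfolding c_def d_def Q_pCons by (simp_all add: Q_def)
    then have Q: "c \<in> Q" "d \<in> Q" "c - d \<in> Q" "d - c \<in> Q" by (simp_all add: Q_diff)
    show "poly c \<pi> \<in> R" "poly d \<pi> \<in> R" unfolding R_def using Q by blast+
    show "N (poly c \<pi>) > 2" "N (poly d \<pi>) > 2" "N (poly c \<pi> - poly d \<pi>) > 2"
      "N (poly d \<pi> - poly c \<pi>) > 2"
      unfolding poly_diff[symmetric] N[OF Q(1)] N[OF Q(2)] N[OF Q(3)] N[OF Q(4)]
      by (simp_all add: c_def d_def deg_def)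
  qed
qed

text \<open>\<open>A\<close> contains a translate of a small box, and the given box embeds piecewise
  into that small box. The two subring constructions cover characteristic zero and positive
  characteristic.\<close>

lemma box_embeds_into_nonempty_interior:
  fixes A :: "('a ^ 'n::finite) set"
  assumes "CARD('n) \<ge> 2" "vec_interior v A \<noteq> {}"
  shows "\<exists>f. piecewise affine_units (vec_box \<rho>) f \<and> f ` vec_box \<rho> \<subseteq> A \<and> inj_on f (vec_box \<rho>)"
proof -
  interpret transformation_group "affine_units :: ('a ^ 'n \<Rightarrow> 'a ^ 'n) set"
    by (rule transformation_group_affine_units)
  obtain i j :: 'n where ij: "i \<noteq> j"
    using assms(1) card_le_Suc0_iff_eq[of "UNIV :: 'n set"] by fastforce
  obtain r c where r: "0 < r" and c: "\<And>x. x \<in> vec_box r \<Longrightarrow> x + c \<in> A"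
    using vec_interior_imp_box_translate[OF assms(2)] by blast
  obtain R N a b where R: "normed_subring R N" "R \<subseteq> ring_of_integers v"
    and ab: "a \<in> R" "b \<in> R" "N a > 2" "N b > 2" "N (a - b) > 2" "N (b - a) > (2::real)"
  proof (cases "inj (of_int :: int \<Rightarrow> 'a)")
    case True
    then show ?thesis by (rule normed_subring_char_0) (rule that)
  next
    case False
    then show ?thesis by (rule normed_subring_char_p) (rule that)
  qed
  obtain f :: "'a ^ 'n \<Rightarrow> 'a ^ 'n" where f: "piecewise affine_units (vec_box \<rho>) f"
      "f ` vec_box \<rho> \<subseteq> vec_box r" "inj_on f (vec_box \<rho>)"
    using box_embeds_into_smaller_box[OF ij r R ab] by blast
  show ?thesis
  proof (intro exI[of _ "\<lambda>x. f x + c"] conjI)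
    show "piecewise affine_units (vec_box \<rho>) (\<lambda>x. f x + c)"
      by (rule piecewise_comp[OF f(1,2) piecewise_single[OF translation_in_affine_units]])
    show "(\<lambda>x. f x + c) ` vec_box \<rho> \<subseteq> A" using f(2) c by auto
    show "inj_on (\<lambda>x. f x + c) (vec_box \<rho>)" using f(3) by (simp add: inj_on_def)
  qed
qed

end

theorem theorem5p5:
  fixes v :: "'a::field \<Rightarrow> real"
    and A B :: "('a ^ 'n::finite) set"
  assumes "nonarch_valuation v"
    and "discrete_valuation v"
    and "finite (residue_field v)"
    and "CARD('n) \<ge> 2"
    and "vec_bounded v A" and "vec_interior v A \<noteq> {}"
    and "vec_bounded v B" and "vec_interior v B \<noteq> {}"
  shows "equidecomposable (special_affine v) A B"
proof -
  interpret local_field_like v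
    by unfold_locales (use assms in auto)
  interpret transformation_group "affine_units :: ('a ^ 'n \<Rightarrow> 'a ^ 'n) set"
    by (rule transformation_group_affine_units)
  \<comment> \<open>Only boundedness of the source and an interior point of the target are used, so
    the embedding is available from \<open>A\<close> to \<open>B\<close> as well as from
    \<open>B\<close> to \<open>A\<close>.\<close>
  have embeds: "\<exists>f. inj_on f C \<and> f ` C \<subseteq> D \<and> piecewise affine_units C f"
    if "vec_bounded v C" "vec_interior v D \<noteq> {}" for C D :: "('a ^ 'n) set"
  proof -
    obtain \<rho> where \<rho>: "C \<subseteq> vec_box \<rho>" using vec_bounded_imp_subset_box[OF \<open>vec_bounded v C\<close>] by blast
    obtain f where f: "piecewise affine_units (vec_box \<rho>) f" "f ` vec_box \<rho> \<subseteq> D"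
        "inj_on f (vec_box \<rho>)"
      using box_embeds_into_nonempty_interior[OF assms(4) \<open>vec_interior v D \<noteq> {}\<close>] by blast
    have "f ` C \<subseteq> D" using f(2) \<rho> by blast
    then show ?thesis using piecewise_subset[OF f(1) \<rho>] inj_on_subset[OF f(3) \<rho>] by blast
  qed
  obtain f where f: "inj_on f A" "f ` A \<subseteq> B" "piecewise affine_units A f"
    using embeds[OF assms(5,8)] by blast
  obtain h where h: "inj_on h B" "h ` B \<subseteq> A" "piecewise affine_units B h"
    using embeds[OF assms(7,6)] by blast
  have "equidecomposable affine_units A B" by (rule Banach_Schroeder_Bernstein[OF f h])
  moreover have "affine_units \<subseteq> special_affine v" unfolding affine_units_def by blast
  ultimately show ?thesis by (rule equidecomposable_mono)
qed

end
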